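(* Let $\mathfrak F$ be a non-trivial commutative group, let $I=\{p,q,r,s,t\}$ be a set with five elements, and let $(\mathcal G,\varphi,C)$ be the shifted group coset system constructed from $\mathfrak F$ as described in the context (for any choice of the data $\langle H_{xy}\rangle$, $\langle\alpha(\pi)\rangle$ and $f$ allowed there). Then the polygroupoid $\mathfrak P(\mathcal G,\varphi,C)$ is not representable.
   Context: **General notation.** Groups are written multiplicatively, with operation $\circ$, identity $e$, inverse $g^{-1}$. For subsets $X,Y$ of a group, $X\circ Y=\{a\circ b: a\in X,b\in Y\}$; singletons are identified with their elements. For a normal subgroup $H$ of a group $\mathfrak G$ with universe $G$: $g/H=g\circ H$, and $G/H$ is the set of cosets of $H$. If $\psi$ is a map defined on the cosets of $H$, whose values are cosets of $K$, and $X$ is a union of cosets of $H$, then $\psi(X)$ or $\psi[X]$ also denotes the union of the values $\psi(g/H)$ over the cosets $g/H\subseteq X$ (a union of cosets is identified with the set of these cosets). Composition of functions (and binary relations) is relational: $R\mid S=\{(u,v): (u,w)\in R,\ (w,v)\in S\text{ for some }w\}$; for functions $(f\mid g)(u)=g(f(u))$. $[u,v]$ denotes the transposition of a given set interchanging $u$ and $v$ and fixing all other elements. **Polygroupoids.** A polygroupoid is a structure $\mathfrak M=(M,\circ,I,{}^{-1})$ where $\circ$ assigns to each pair $a,b\in M$ a (possibly empty) subset $a\circ b\subseteq M$ (extended to subsets by $X\circ Y=\bigcup\{a\circ b:a\in X,b\in Y\}$), $I\subseteq M$, ${}^{-1}$ is a unary operation on $M$, and for all $a,b,c\in M$: (i)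 $(a\circ b)\circ c=a\circ(b\circ c)$; (ii) $a\circ I=\{a\}=I\circ a$; (iii) $a\in b\circ c$ iff $b\in a\circ c^{-1}$ iff $c\in b^{-1}\circ a$. **Representability.** A representation of $\mathfrak M$ on a set $U$ is a function $\mathrm{rep}$ assigning to each $a\in M$ a nonempty binary relation $\mathrm{rep}(a)\subseteq U\times U$, with $\mathrm{rep}(a)\cap \mathrm{rep}(b)=\emptyset$ for $a\neq b$, such that for all $a,b\in M$: $\mathrm{rep}(a)\mid \mathrm{rep}(b)=\bigcup\{\mathrm{rep}(c): c\in a\circ b\}$; $\mathrm{rep}(x)\subseteq\{(u,u):u\in U\}$ for $x\in I$; and $\mathrm{rep}(a)^{-1}=\mathrm{rep}(a^{-1})$, where $R^{-1}=\{(v,u):(u,v)\in R\}$. $\mathfrak M$ is representable if it has a representation on some set. **The group system.** Let $F$ be the universe of $\mathfrak F$. Let $L_0=\{(a,e,e):a\in F\}$, $L_1=\{(e,a,e):a\in F\}$, $L_2=\{(e,e,a):a\in F\}$, $L_3=\{(a,a,a):a\in F\}$, subgroups of $\mathfrak F\times\mathfrak F\times\mathfrak F$. Put $\mathfrak G_x=\mathfrak F\times\mathfrak F\times\mathfrak F$ for all $x\in I$, and $\mathcal G=\langle\mathfrak G_x:x\in I\rangle$. Let $H_{xx}=\{e\}$ (the trivial subgroup), and for distinct $x,y\in I$ choose $H_{xy}\in\{L_0,L_1,L_2,L_3\}$ so that $\{H_{xy}:y\in I,y\neq x\}=\{L_i:i<4\}$ for each $x\in I$. For distinct $x,y\in I$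 let $\pi_{xy}$ be the permutation of $\{L_i:i<4\}$ with $\pi_{xy}(H_{xy})=H_{yx}$ and $\pi_{xy}(H_{xu})=H_{yu}$ for $u\in I\setminus\{x,y\}$. Let $\Pi$ be the set of permutations of $\{L_i:i<4\}$ and let $\langle\alpha(\pi):\pi\in\Pi\rangle$ be a system of automorphisms of $\mathfrak F\times\mathfrak F\times\mathfrak F$ such that for all $\pi,\sigma\in\Pi$: $\alpha(\pi)[L_m]=\pi(L_m)$ for $m<4$; $\alpha$ of the identity permutation is the identity; $\alpha(\pi^{-1})=\alpha(\pi)^{-1}$; $\alpha(\pi)\mid\alpha(\sigma)=\alpha(\pi\mid\sigma)$; and for distinct $m,n,k<4$, $\alpha([L_m,L_n])$ is the identity on $L_k$. Put $\alpha_{xy}=\alpha(\pi_{xy})$ for $x\ne y$ and let $\varphi_{xy}:\mathfrak G_x/H_{xy}\to\mathfrak G_y/H_{yx}$ be given by $\varphi_{xy}(g/H_{xy})=\alpha_{xy}(g)/H_{yx}$; let $\varphi_{xx}$ be the identity on $\mathfrak G_x/\{e\}$. Put $\varphi=\langle\varphi_{xy}:x,y\in I\rangle$. **The shift.** Let $f\in F\times F\times F$ with $f\notin H_{pq}\circ H_{pr}$, and put $f_p=f$, $f_q=\alpha_{pq}(f)$, $f_r=\alpha_{pr}(f)$. Call $(p,q,r),(q,r,p),(r,p,q)$ the positive permutations of $(p,q,r)$ and the other three permutations negative. Define $C=\langle C_{xyz}:x,y,z\in I\rangle$ by: $C_{xyz}=f_x/(H_{xy}\circ H_{xz})$ if $(x,y,z)$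 is a positive permutation of $(p,q,r)$; $C_{xyz}=f_x^{-1}/(H_{xy}\circ H_{xz})$ if it is a negative permutation of $(p,q,r)$; $C_{xyz}=H_{xy}\circ H_{xz}$ if $(x,y,z)$ is not a permutation of $(p,q,r)$. **The structure $\mathfrak P(\mathcal G,\varphi,C)$.** Its universe is $P=\{(x,g,y): x,y\in I,\ g\in G_x/H_{xy}\}$, where $G_x$ is the universe of $\mathfrak G_x$. The product of $(x,g,y)$ and $(w,h,z)$ is undefined (empty) if $y\neq w$, and $$(x,g,y)(y,h,z)=\{(x,k,z): k\in G_x/H_{xz},\ k\subseteq\varphi_{yx}(\varphi_{xy}(g)\circ h)\circ C_{xyz}\}.$$ The set of identities is $\{(x,H_{xx},x):x\in I\}$, and $(x,g,y)^{-1}=(y,\varphi_{xy}(g^{-1}),x)$. *)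

theory Defs
  imports "HOL-Algebra.Left_Coset" "HOL-Combinatorics.Permutations"
begin

section \<open>Polygroupoids and their representations\<close>

record 'm poly_structure = "'m partial_object" +
  pmult :: "'m \<Rightarrow> 'm \<Rightarrow> 'm set"
  pidents :: "'m set"
  pinv :: "'m \<Rightarrow> 'm"

definition pmult_set :: "('m, 'b) poly_structure_scheme \<Rightarrow> 'm set \<Rightarrow> 'm set \<Rightarrow> 'm set" where
  "pmult_set M X Y = (\<Union>a\<in>X. \<Union>b\<in>Y. pmult M a b)"

locale polygroupoid =
  fixes M :: "('m, 'b) poly_structure_scheme"
  assumes pmult_closed: "\<lbrakk>a \<in> carrier M; b \<in> carrier M\<rbrakk> \<Longrightarrow> pmult M a b \<subseteq> carrier M"
    and pidents_closed: "pidents M \<subseteq> carrier M"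
    and pinv_closed: "a \<in> carrier M \<Longrightarrow> pinv M a \<in> carrier M"
    and assoc: "\<lbrakk>a \<in> carrier M; b \<in> carrier M; c \<in> carrier M\<rbrakk> \<Longrightarrow>
      pmult_set M (pmult M a b) {c} = pmult_set M {a} (pmult M b c)"
    and right_ident: "a \<in> carrier M \<Longrightarrow> pmult_set M {a} (pidents M) = {a}"
    and left_ident: "a \<in> carrier M \<Longrightarrow> pmult_set M (pidents M) {a} = {a}"
    and cycle_right: "\<lbrakk>a \<in> carrier M; b \<in> carrier M; c \<in> carrier M\<rbrakk> \<Longrightarrow>
      a \<in> pmult M b c \<longleftrightarrow> b \<in> pmult M a (pinv M c)"
    and cycle_left: "\<lbrakk>a \<in> carrier M; b \<in> carrier M; c \<in> carrier M\<rbrakk> \<Longrightarrow>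
      b \<in> pmult M a (pinv M c) \<longleftrightarrow> c \<in> pmult M (pinv M b) a"

definition representation ::
  "('m, 'b) poly_structure_scheme \<Rightarrow> 'u set \<Rightarrow> ('m \<Rightarrow> ('u \<times> 'u) set) \<Rightarrow> bool" where
  "representation M U rep \<longleftrightarrow>
     (\<forall>a\<in>carrier M. rep a \<noteq> {} \<and> rep a \<subseteq> U \<times> U) \<and>
     (\<forall>a\<in>carrier M. \<forall>b\<in>carrier M. a \<noteq> b \<longrightarrow> rep a \<inter> rep b = {}) \<and>
     (\<forall>a\<in>carrier M. \<forall>b\<in>carrier M. rep a O rep b = (\<Union>c\<in>pmult M a b. rep c)) \<and>
     (\<forall>x\<in>pidents M. rep x \<subseteq> Id_on U) \<and>
     (\<forall>a\<in>carrier M. (rep a)\<inverse> = rep (pinv M a))"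

text \<open>A definition cannot quantify over types, so the type of the points of the base set is an
  argument. A statement about \<open>representable TYPE('u) M\<close> with \<open>'u\<close> a free type variable
  is a statement about base sets of every type.\<close>

definition representable :: "'u itself \<Rightarrow> ('m, 'b) poly_structure_scheme \<Rightarrow> bool" where
  "representable (T :: 'u itself) M \<longleftrightarrow> (\<exists>(U :: 'u set) rep. representation M U rep)"


section \<open>The group system\<close>

type_synonym 'a triple = "'a \<times> 'a \<times> 'a"

abbreviation cube :: "('a, 'b) monoid_scheme \<Rightarrow> 'a triple monoid" where
  "cube F \<equiv> F \<times>\<times> F \<times>\<times> F"

definition L :: "('a, 'b) monoid_scheme \<Rightarrow> nat \<Rightarrow> 'a triple set" where
  "L F m =
     (if m = 0 then {(a, \<one>\<^bsub>F\<^esub>, \<one>\<^bsub>F\<^esub>) | a. a \<in> carrier F}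
      else if m = 1 then {(\<one>\<^bsub>F\<^esub>, a, \<one>\<^bsub>F\<^esub>) | a. a \<in> carrier F}
      else if m = 2 then {(\<one>\<^bsub>F\<^esub>, \<one>\<^bsub>F\<^esub>, a) | a. a \<in> carrier F}
      else {(a, a, a) | a. a \<in> carrier F})"

abbreviation Ls :: "('a, 'b) monoid_scheme \<Rightarrow> 'a triple set set" where
  "Ls F \<equiv> L F ` {..<4}"

definition subgroup_choice ::
  "('a, 'b) monoid_scheme \<Rightarrow> 'i set \<Rightarrow> ('i \<Rightarrow> 'i \<Rightarrow> 'a triple set) \<Rightarrow> bool" where
  "subgroup_choice F I H \<longleftrightarrow>
     (\<forall>x\<in>I. H x x = {\<one>\<^bsub>cube F\<^esub>}) \<and>
     (\<forall>x\<in>I. \<forall>y\<in>I. x \<noteq> y \<longrightarrow> H x y \<in> Ls F) \<and>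
     (\<forall>x\<in>I. {H x y | y. y \<in> I \<and> y \<noteq> x} = Ls F)"

text \<open>The permutation \<open>\<pi>\<^sub>x\<^sub>y\<close>. Permutations of \<open>Ls F\<close> are, as usual with \<open>permutes\<close>,
  functions that are the identity outside \<open>Ls F\<close>, so the description determines a unique function
  for distinct \<open>x\<close>, \<open>y\<close> in a five-element index set.\<close>

definition perm ::
  "('a, 'b) monoid_scheme \<Rightarrow> 'i set \<Rightarrow> ('i \<Rightarrow> 'i \<Rightarrow> 'a triple set) \<Rightarrow> 'i \<Rightarrow> 'i \<Rightarrow>
   ('a triple set \<Rightarrow> 'a triple set)" where
  "perm F I H x y = (THE \<pi>. \<pi> permutes Ls F \<and> \<pi> (H x y) = H y x \<and>
     (\<forall>u\<in>I - {x, y}. \<pi> (H x u) = H y u))"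

text \<open>Elements of \<open>iso\<close> are unconstrained outside the carrier, so the identities between
  automorphisms are required on the carrier. The relational product of functions \<open>\<pi> | \<sigma>\<close> is
  \<open>\<sigma> \<circ> \<pi>\<close>.\<close>

definition automorphism_system ::
  "('a, 'b) monoid_scheme \<Rightarrow>
   (('a triple set \<Rightarrow> 'a triple set) \<Rightarrow> 'a triple \<Rightarrow> 'a triple) \<Rightarrow> bool" where
  "automorphism_system F \<alpha> \<longleftrightarrow>
     (\<forall>\<pi>. \<pi> permutes Ls F \<longrightarrow> \<alpha> \<pi> \<in> iso (cube F) (cube F)) \<and>
     (\<forall>\<pi>. \<pi> permutes Ls F \<longrightarrow> (\<forall>m<4. \<alpha> \<pi> ` L F m = \<pi> (L F m))) \<and>
     (\<forall>g\<in>carrier (cube F). \<alpha> id g = g) \<and>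
     (\<forall>\<pi>. \<pi> permutes Ls F \<longrightarrow>
        (\<forall>g\<in>carrier (cube F). \<alpha> (inv_into UNIV \<pi>) g = inv_into (carrier (cube F)) (\<alpha> \<pi>) g)) \<and>
     (\<forall>\<pi> \<sigma>. \<pi> permutes Ls F \<longrightarrow> \<sigma> permutes Ls F \<longrightarrow>
        (\<forall>g\<in>carrier (cube F). \<alpha> \<sigma> (\<alpha> \<pi> g) = \<alpha> (\<sigma> \<circ> \<pi>) g)) \<and>
     (\<forall>m<4. \<forall>n<4. \<forall>k<4. distinct [m, n, k] \<longrightarrow>
        (\<forall>g\<in>L F k. \<alpha> (Transposition.transpose (L F m) (L F n)) g = g))"

definition alpha_map where
  "alpha_map F I H \<alpha> x y = \<alpha> (perm F I H x y)"

text \<open>The map \<open>\<phi>\<^sub>x\<^sub>y\<close> in its extended form, defined on arbitrary unions \<open>X\<close> of cosets of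
  \<open>H\<^sub>x\<^sub>y\<close>: the union of the values \<open>\<alpha>\<^sub>x\<^sub>y(g)/H\<^sub>y\<^sub>x\<close> over the cosets \<open>g/H\<^sub>x\<^sub>y \<subseteq> X\<close>. If \<open>X\<close> is a
  single coset, this is the value of \<open>\<phi>\<^sub>x\<^sub>y\<close> at that coset.\<close>

definition phi ::
  "('a, 'b) monoid_scheme \<Rightarrow> 'i set \<Rightarrow> ('i \<Rightarrow> 'i \<Rightarrow> 'a triple set) \<Rightarrow>
   (('a triple set \<Rightarrow> 'a triple set) \<Rightarrow> 'a triple \<Rightarrow> 'a triple) \<Rightarrow>
   'i \<Rightarrow> 'i \<Rightarrow> 'a triple set \<Rightarrow> 'a triple set" where
  "phi F I H \<alpha> x y X =
     (if x = y then X
      else \<Union> {alpha_map F I H \<alpha> x y g <#\<^bsub>cube F\<^esub> H y x | g.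
                g \<in> carrier (cube F) \<and> g <#\<^bsub>cube F\<^esub> H x y \<subseteq> X})"


section \<open>The shift\<close>

definition shift_elem where
  "shift_elem F I H \<alpha> f p x = (if x = p then f else alpha_map F I H \<alpha> p x f)"

definition shift ::
  "('a, 'b) monoid_scheme \<Rightarrow> 'i set \<Rightarrow> ('i \<Rightarrow> 'i \<Rightarrow> 'a triple set) \<Rightarrow>
   (('a triple set \<Rightarrow> 'a triple set) \<Rightarrow> 'a triple \<Rightarrow> 'a triple) \<Rightarrow>
   'a triple \<Rightarrow> 'i \<Rightarrow> 'i \<Rightarrow> 'i \<Rightarrow> 'i \<Rightarrow> 'i \<Rightarrow> 'i \<Rightarrow> 'a triple set" where
  "shift F I H \<alpha> f p q r x y z =
     (let K = H x y <#>\<^bsub>cube F\<^esub> H x z; f\<^sub>x = shift_elem F I H \<alpha> f p x in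
      if (x, y, z) \<in> {(p, q, r), (q, r, p), (r, p, q)} then f\<^sub>x <#\<^bsub>cube F\<^esub> K
      else if (x, y, z) \<in> {(p, r, q), (q, p, r), (r, q, p)}
        then inv\<^bsub>cube F\<^esub> f\<^sub>x <#\<^bsub>cube F\<^esub> K
      else K)"


section \<open>The structure of cosets\<close>

text \<open>For all \<open>x\<close> the group \<open>\<GG>\<^sub>x\<close> is \<open>G\<close>; \<open>\<phi>\<close> is a system of maps extended to unions of
  cosets, as \<open>phi\<close> above.\<close>

definition coset_structure ::
  "('g, 'b) monoid_scheme \<Rightarrow> 'i set \<Rightarrow> ('i \<Rightarrow> 'i \<Rightarrow> 'g set) \<Rightarrow>
   ('i \<Rightarrow> 'i \<Rightarrow> 'g set \<Rightarrow> 'g set) \<Rightarrow> ('i \<Rightarrow> 'i \<Rightarrow> 'i \<Rightarrow> 'g set) \<Rightarrow>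
   ('i \<times> 'g set \<times> 'i) poly_structure" where
  "coset_structure G I H \<phi> C =
     \<lparr>carrier = {(x, g, y) | x g y. x \<in> I \<and> y \<in> I \<and> g \<in> lcosets\<^bsub>G\<^esub> (H x y)},
      pmult = (\<lambda>(x, g, y) (w, h, z).
        if y \<noteq> w then {}
        else {(x, k, z) | k. k \<in> lcosets\<^bsub>G\<^esub> (H x z) \<and>
               k \<subseteq> \<phi> y x (\<phi> x y g <#>\<^bsub>G\<^esub> h) <#>\<^bsub>G\<^esub> C x y z}),
      pidents = {(x, H x x, x) | x. x \<in> I},
      pinv = (\<lambda>(x, g, y). (y, \<phi> x y (set_inv\<^bsub>G\<^esub> g), x))\<rparr>"

definition shifted_structure where
  "shifted_structure F I H \<alpha> f p q r =
     coset_structure (cube F) I H (phi F I H \<alpha>) (shift F I H \<alpha> f p q r)"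

end

theory Submission
  imports Defs
begin

text \<open>
  The group at each index is the direct product of any three of the four subgroups
  \<open>H\<^sub>x\<^sub>y\<close>, and the automorphisms \<open>\<alpha>\<^sub>x\<^sub>y\<close> compose correctly up to
  \<open>H\<^sub>x\<^sub>y \<circ> H\<^sub>x\<^sub>z\<close>. Hence the product of \<open>(x, a/H\<^sub>x\<^sub>y, y)\<close> and \<open>(y, b/H\<^sub>y\<^sub>z, z)\<close>
  consists of the \<open>(x, d/H\<^sub>x\<^sub>z, z)\<close> with \<open>d \<equiv> a \<alpha>\<^sub>y\<^sub>x(b) c\<^sub>x\<^sub>y\<^sub>z\<close> modulo
  \<open>H\<^sub>x\<^sub>y \<circ> H\<^sub>x\<^sub>z\<close>. Associativity then becomes a cocycle condition on the shift modulo
  \<open>H\<^sub>x\<^sub>y \<circ> H\<^sub>x\<^sub>z \<circ> H\<^sub>x\<^sub>w\<close>, which is the whole group when the four indices are distinct.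

  In a representation one finds a point at \<open>p\<close> joined to points at \<open>q, r, s, t\<close> by the trivial
  cosets. The label of the edge between the points at \<open>y\<close> and \<open>z\<close>, transported to \<open>p\<close>, is then
  \<open>c\<^sub>p\<^sub>y\<^sub>z\<^sup>-\<^sup>1 h\<^sub>y\<^sub>z\<close> for some \<open>h\<^sub>y\<^sub>z\<close> in \<open>H\<^sub>p\<^sub>y\<close>. The triangles \<open>qst\<close>, \<open>rst\<close>
  and \<open>qrs\<close> determine \<open>h\<^sub>q\<^sub>t\<close>, \<open>h\<^sub>r\<^sub>t\<close> and \<open>h\<^sub>q\<^sub>s\<close>, and then \<open>qrt\<close> forces the
  component of \<open>f\<close> in \<open>H\<^sub>p\<^sub>s\<close> to be trivial, so that \<open>f\<close> lies in \<open>H\<^sub>p\<^sub>q \<circ> H\<^sub>p\<^sub>r\<close>.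
\<close>

no_notation subset_mset (infix \<open><#\<close> 50)

section \<open>Congruence modulo a subgroup of a commutative group\<close>

context comm_group
begin

text \<open>Membership of both sides in the carrier is built in, so that a single congruence also
  supplies the typing facts about its two sides.\<close>

definition cmod :: "'a set \<Rightarrow> 'a \<Rightarrow> 'a \<Rightarrow> bool" where
  "cmod N a b \<longleftrightarrow> a \<in> carrier G \<and> b \<in> carrier G \<and> (\<exists>n\<in>N. a = b \<otimes> n)"

lemma cmod_carrier:
  assumes "cmod N a b"
  shows "a \<in> carrier G" "b \<in> carrier G"
  using assms by (auto simp: cmod_def)

lemma cmod_refl: "subgroup N G \<Longrightarrow> a \<in> carrier G \<Longrightarrow> cmod N a a"
  unfolding cmod_def using subgroup.one_closed by force

lemma cmod_sym:
  assumes "subgroup N G" "cmod N a b"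
  shows "cmod N b a"
proof -
  obtain n where n: "n \<in> N" "a = b \<otimes> n" "a \<in> carrier G" "b \<in> carrier G"
    using assms by (auto simp: cmod_def)
  then have "n \<in> carrier G" using assms(1) by (simp add: subgroup.mem_carrier)
  then have "b = a \<otimes> inv n" using n by (simp add: m_assoc)
  with n assms(1) show ?thesis
    by (auto simp: cmod_def intro!: bexI[of _ "inv n"] subgroup.m_inv_closed)
qed

lemma cmod_trans:
  assumes "subgroup N G" "cmod N a b" "cmod N b c"
  shows "cmod N a c"
proof -
  obtain n m where n: "n \<in> N" "a = b \<otimes> n" "m \<in> N" "b = c \<otimes> m" "a \<in> carrier G" "c \<in> carrier G"
    using assms by (auto simp: cmod_def)
  then have "n \<in> carrier G" "m \<in> carrier G" using assms(1) by (simp_all add: subgroup.mem_carrier)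
  then have "a = c \<otimes> (m \<otimes> n)" using n by (simp add: m_assoc)
  moreover have "m \<otimes> n \<in> N" using n assms(1) by (simp add: subgroup.m_closed)
  ultimately show ?thesis using n(5,6) unfolding cmod_def by blast
qed

lemma cmod_mult:
  assumes "subgroup N G" "cmod N a b" "cmod N a' b'"
  shows "cmod N (a \<otimes> a') (b \<otimes> b')"
proof -
  obtain n m where n: "n \<in> N" "a = b \<otimes> n" "m \<in> N" "a' = b' \<otimes> m"
    "b \<in> carrier G" "b' \<in> carrier G"
    using assms by (auto simp: cmod_def)
  then have "n \<in> carrier G" "m \<in> carrier G" using assms(1) by (simp_all add: subgroup.mem_carrier)
  then have "a \<otimes> a' = (b \<otimes> b') \<otimes> (n \<otimes> m)" using n by (simp add: m_ac)
  moreover have "n \<otimes> m \<in> N" using n assms(1) by (simp add: subgroup.m_closed)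
  moreover have "a \<in> carrier G" "a' \<in> carrier G" using assms(2,3) cmod_carrier by blast+
  ultimately show ?thesis using n(5,6) unfolding cmod_def by blast
qed

lemma cmod_mono: "cmod N a b \<Longrightarrow> N \<subseteq> N' \<Longrightarrow> cmod N' a b"
  by (auto simp: cmod_def)

lemma cmod_cancel:
  assumes "subgroup N G" "a \<in> carrier G" "b \<in> carrier G" "u \<in> carrier G"
  shows "cmod N (u \<otimes> a) (u \<otimes> b) \<longleftrightarrow> cmod N a b"
proof
  assume *: "cmod N (u \<otimes> a) (u \<otimes> b)"
  have "cmod N (inv u \<otimes> (u \<otimes> a)) (inv u \<otimes> (u \<otimes> b))"
    by (intro cmod_mult cmod_refl *) (use assms in auto)
  then show "cmod N a b" using assms by (simp add: m_assoc [symmetric])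
next
  assume "cmod N a b"
  then show "cmod N (u \<otimes> a) (u \<otimes> b)"
    by (intro cmod_mult cmod_refl) (use assms in auto)
qed

lemma cmod_mem:
  assumes "subgroup N G" "h \<in> N" "a \<in> carrier G"
  shows "cmod N (a \<otimes> h) a"
  using assms by (auto simp: cmod_def subgroup.mem_carrier)

lemma cmod_iff_mem:
  assumes "subgroup N G" "a \<in> carrier G" "b \<in> carrier G"
  shows "cmod N a b \<longleftrightarrow> a \<otimes> inv b \<in> N"
proof
  assume "cmod N a b"
  then obtain n where "n \<in> N" "a = b \<otimes> n" by (auto simp: cmod_def)
  moreover then have "n \<in> carrier G" using assms by (simp add: subgroup.mem_carrier)
  ultimately show "a \<otimes> inv b \<in> N" using assms by (simp add: m_comm[of b] m_assoc)
next
  assume "a \<otimes> inv b \<in> N"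
  then show "cmod N a b"
    using assms by (auto simp: cmod_def m_lcomm intro!: bexI[of _ "a \<otimes> inv b"])
qed

section \<open>Cosets in terms of congruences\<close>

lemma cmod_l_coset:
  assumes "subgroup N G" "a \<in> carrier G"
  shows "d \<in> a <# N \<longleftrightarrow> cmod N d a"
  using assms by (auto simp: cmod_def l_coset_def subgroup.mem_carrier)

lemma l_coset_eq_iff_cmod:
  assumes "subgroup N G" "a \<in> carrier G" "b \<in> carrier G"
  shows "a <# N = b <# N \<longleftrightarrow> cmod N a b"
  using assms
  by (metis cmod_l_coset l_repr_independence lcos_self)

text \<open>As \<open>N\<close> lies in \<open>K\<close>, a coset of \<open>N\<close> that meets a
  coset of \<open>K\<close> is contained in it. Products in the structure are defined by such
  inclusions, and are turned into congruences here.\<close>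

lemma l_coset_subset_iff_cmod:
  assumes "subgroup N G" "subgroup K G" "N \<subseteq> K" "a \<in> carrier G" "b \<in> carrier G"
  shows "a <# N \<subseteq> b <# K \<longleftrightarrow> cmod K a b"
proof
  assume "a <# N \<subseteq> b <# K"
  then show "cmod K a b" using assms lcos_self[of a N] cmod_l_coset by blast
next
  assume *: "cmod K a b"
  show "a <# N \<subseteq> b <# K"
  proof
    fix d assume "d \<in> a <# N"
    then have "cmod K d a" using assms by (meson cmod_l_coset cmod_mono)
    then show "d \<in> b <# K" using assms * by (meson cmod_l_coset cmod_trans)
  qed
qed

lemma set_multI: "a \<in> A \<Longrightarrow> b \<in> B \<Longrightarrow> a \<otimes> b \<in> A <#> B"
  by (auto simp: set_mult_def)

lemma subgroup_set_mult_upper: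
  assumes "subgroup A G" "subgroup B G"
  shows "A \<subseteq> A <#> B" "B \<subseteq> A <#> B"
  using assms subgroup.one_closed[OF assms(1)] subgroup.one_closed[OF assms(2)]
  by (force simp: set_mult_def subgroup.mem_carrier)+

lemma set_mult_subset_subgroup:
  assumes "A \<subseteq> N" "B \<subseteq> N" "subgroup N G"
  shows "A <#> B \<subseteq> N"
  using assms by (auto simp: set_mult_def subgroup.m_closed subset_iff)

lemma set_mult_commute_subset:
  assumes "A \<subseteq> carrier G" "B \<subseteq> carrier G"
  shows "A <#> B = B <#> A"
proof -
  have *: "a \<otimes> b = b \<otimes> a" if "a \<in> A" "b \<in> B" for a b
    using that assms by (intro m_comm) auto
  show ?thesis unfolding set_mult_def
    by (intro equalityI subsetI; clarsimp) (metis *)+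
qed

lemma l_coset_set_mult_l_coset:
  assumes "subgroup A G" "subgroup B G" "a \<in> carrier G" "b \<in> carrier G"
  shows "(a <# A) <#> (b <# B) = (a \<otimes> b) <# (A <#> B)"
proof -
  have "a \<otimes> h \<otimes> (b \<otimes> k) = a \<otimes> b \<otimes> (h \<otimes> k)" if "h \<in> A" "k \<in> B" for h k
  proof -
    have "h \<in> carrier G" "k \<in> carrier G" using that assms by (auto simp: subgroup.mem_carrier)
    then show ?thesis using assms by (simp add: m_ac)
  qed
  then show ?thesis
    by (fastforce simp: l_coset_def set_mult_def)
qed

lemma set_inv_l_coset:
  assumes "subgroup A G" "a \<in> carrier G"
  shows "set_inv (a <# A) = inv a <# A"
proof -
  have *: "inv (a \<otimes> h) = inv a \<otimes> inv h" if "h \<in> A" for h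
    using that assms by (simp add: inv_mult subgroup.mem_carrier)
  show ?thesis
  proof
    show "set_inv (a <# A) \<subseteq> inv a <# A"
      using * assms by (auto simp: SET_INV_def l_coset_def intro: subgroup.m_inv_closed)
    have "inv a \<otimes> h = inv (a \<otimes> inv h) \<and> inv h \<in> A" if "h \<in> A" for h
      using that assms *[of "inv h"] by (simp add: subgroup.m_inv_closed subgroup.mem_carrier)
    then show "inv a <# A \<subseteq> set_inv (a <# A)"
      by (fastforce simp: SET_INV_def l_coset_def)
  qed
qed

text \<open>Eliminates the intermediate element of a triple product: the freedom of \<open>l\<close>
  within its coset of \<open>N\<close> reappears, after \<open>h\<close>, as the factor of the
  modulus that is the image of \<open>N\<close>.\<close>

lemma cmod_compose:
  assumes "subgroup N G" "subgroup M G" "h \<in> hom G G"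
    and "a \<in> carrier G" "b \<in> carrier G"
  shows "(\<exists>l\<in>carrier G. cmod N l b \<and> cmod M d (a \<otimes> h l)) \<longleftrightarrow>
    cmod ((h ` N) <#> M) d (a \<otimes> h b)"
proof -
  have h: "h g \<in> carrier G" if "g \<in> carrier G" for g
    using assms(3) that by (rule hom_in_carrier)
  have *: "a \<otimes> h (b \<otimes> n) \<otimes> m = a \<otimes> h b \<otimes> (h n \<otimes> m)" if "n \<in> N" "m \<in> M" for n m
  proof -
    have "n \<in> carrier G" "m \<in> carrier G" using that assms by (auto simp: subgroup.mem_carrier)
    then show ?thesis using assms h by (simp add: hom_mult[OF assms(3)] m_assoc)
  qed
  show ?thesis
  proof
    assume "\<exists>l\<in>carrier G. cmod N l b \<and> cmod M d (a \<otimes> h l)"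
    then obtain n m where "n \<in> N" "m \<in> M" "d \<in> carrier G" "d = a \<otimes> h (b \<otimes> n) \<otimes> m"
      unfolding cmod_def by blast
    then show "cmod ((h ` N) <#> M) d (a \<otimes> h b)"
      using assms h * unfolding cmod_def set_mult_def by fastforce
  next
    assume "cmod ((h ` N) <#> M) d (a \<otimes> h b)"
    then obtain n m where nm: "n \<in> N" "m \<in> M" "d \<in> carrier G" "d = a \<otimes> h b \<otimes> (h n \<otimes> m)"
      unfolding cmod_def set_mult_def by blast
    then have "b \<otimes> n \<in> carrier G" using assms by (simp add: subgroup.mem_carrier)
    then show "\<exists>l\<in>carrier G. cmod N l b \<and> cmod M d (a \<otimes> h l)"
      using nm assms h * unfolding cmod_def by (intro bexI[of _ "b \<otimes> n"]) auto
  qed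
qed

text \<open>All factors commute, so a congruence for \<open>d\<close> can be solved for
  \<open>a\<close>, while \<open>u\<close> and \<open>c\<close> are exchanged for congruent
  elements. The cycle laws need the exchange because transports around a triangle agree only up to
  the modulus.\<close>

lemma cmod_solve:
  assumes N: "subgroup N G"
    and c: "d \<in> carrier G" "a \<in> carrier G" and vu: "cmod N v u" and wc: "cmod N w c"
  shows "cmod N d (a \<otimes> u \<otimes> c) \<longleftrightarrow> cmod N a (d \<otimes> inv v \<otimes> inv w)"
proof -
  note [simp] = c cmod_carrier[OF vu] cmod_carrier[OF wc]
  have "(v \<otimes> w) \<otimes> (d \<otimes> inv (v \<otimes> w)) = d"
    by (simp only: m_lcomm[of "v \<otimes> w"] c m_closed inv_closed cmod_carrier[OF vu] cmod_carrier[OF wc]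
        r_inv r_one)
  moreover have "d \<otimes> inv v \<otimes> inv w = d \<otimes> inv (v \<otimes> w)"
    by (simp add: inv_mult m_assoc)
  ultimately have "cmod N a (d \<otimes> inv v \<otimes> inv w) \<longleftrightarrow> cmod N ((v \<otimes> w) \<otimes> a) d"
    using cmod_cancel[OF N, of a "d \<otimes> inv (v \<otimes> w)" "v \<otimes> w"] by simp
  also have "\<dots> \<longleftrightarrow> cmod N ((u \<otimes> c) \<otimes> a) d"
  proof -
    have "cmod N ((v \<otimes> w) \<otimes> a) ((u \<otimes> c) \<otimes> a)"
      by (intro cmod_mult cmod_refl N vu wc c)
    then show ?thesis using cmod_trans[OF N] cmod_sym[OF N] by blast
  qed
  also have "\<dots> \<longleftrightarrow> cmod N d (a \<otimes> u \<otimes> c)"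
    using cmod_sym[OF N] by (auto simp: m_ac)
  finally show ?thesis by simp
qed

lemma cmod_inv:
  assumes "subgroup N G" "cmod N a b"
  shows "cmod N (inv a) (inv b)"
proof -
  have "a \<otimes> inv b \<in> N" "a \<in> carrier G" "b \<in> carrier G"
    using assms cmod_carrier cmod_iff_mem by blast+
  then have "inv (a \<otimes> inv b) \<in> N" using assms(1) by (simp add: subgroup.m_inv_closed)
  with \<open>a \<in> carrier G\<close> \<open>b \<in> carrier G\<close> assms(1) show ?thesis
    by (simp add: cmod_iff_mem inv_mult)
qed

end

section \<open>Frames of subgroups in general position\<close>

text \<open>The map \<open>\<beta> x y\<close> stands for \<open>\<alpha>\<^sub>x\<^sub>y\<close>, extended by the identity for \<open>x = y\<close>;
  \<open>\<beta>_comp\<close> is all that is kept of the composition law of the \<open>\<alpha>(\<pi>)\<close> and of their action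
  on the \<open>L\<^sub>k\<close>.\<close>

locale coset_frame = comm_group G for G (structure) +
  fixes I :: "'i set" and H :: "'i \<Rightarrow> 'i \<Rightarrow> 'a set" and \<beta> :: "'i \<Rightarrow> 'i \<Rightarrow> 'a \<Rightarrow> 'a"
  assumes H_subgroup: "\<lbrakk>x \<in> I; y \<in> I\<rbrakk> \<Longrightarrow> subgroup (H x y) G"
    and H_diag: "x \<in> I \<Longrightarrow> H x x = {\<one>}"
    and \<beta>_hom: "\<lbrakk>x \<in> I; y \<in> I\<rbrakk> \<Longrightarrow> \<beta> x y \<in> hom G G"
    and \<beta>_diag: "\<lbrakk>x \<in> I; g \<in> carrier G\<rbrakk> \<Longrightarrow> \<beta> x x g = g"
    and \<beta>_inverse: "\<lbrakk>x \<in> I; y \<in> I; g \<in> carrier G\<rbrakk> \<Longrightarrow> \<beta> y x (\<beta> x y g) = g"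
    and \<beta>_H_own: "\<lbrakk>x \<in> I; y \<in> I; h \<in> H x y\<rbrakk> \<Longrightarrow> \<beta> x y h \<in> H y x"
    and \<beta>_H_other: "\<lbrakk>x \<in> I; y \<in> I; z \<in> I; distinct [x, y, z]; h \<in> H x z\<rbrakk> \<Longrightarrow> \<beta> x y h \<in> H y z"
    and \<beta>_comp: "\<lbrakk>{x, y, z, w} \<subseteq> I; distinct [x, y, z, w]; h \<in> H x w\<rbrakk> \<Longrightarrow>
      \<beta> y z (\<beta> x y h) = \<beta> x z h"
    and span: "\<lbrakk>{x, y, z, w} \<subseteq> I; distinct [x, y, z, w]; g \<in> carrier G\<rbrakk> \<Longrightarrow>
      \<exists>a\<in>H x y. \<exists>b\<in>H x z. \<exists>d\<in>H x w. g = a \<otimes> b \<otimes> d"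
    and indep: "\<lbrakk>{x, y, z, w} \<subseteq> I; distinct [x, y, z, w]; h \<in> H x y; h \<in> H x z <#> H x w\<rbrakk> \<Longrightarrow>
      h = \<one>"
    and ex_fourth: "\<lbrakk>x \<in> I; y \<in> I; z \<in> I\<rbrakk> \<Longrightarrow> \<exists>w\<in>I. w \<notin> {x, y, z}"
begin

section \<open>Products of two subgroups at one index and their transport\<close>

abbreviation K :: "'i \<Rightarrow> 'i \<Rightarrow> 'i \<Rightarrow> 'a set" where
  "K x y z \<equiv> H x y <#> H x z"

lemma K_subgroup: "\<lbrakk>x \<in> I; y \<in> I; z \<in> I\<rbrakk> \<Longrightarrow> subgroup (K x y z) G"
  by (simp add: H_subgroup mult_subgroups)

lemma H_subset: "\<lbrakk>x \<in> I; y \<in> I\<rbrakk> \<Longrightarrow> H x y \<subseteq> carrier G"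
  by (simp add: H_subgroup subgroup.subset)

lemma K_commute: "\<lbrakk>x \<in> I; y \<in> I; z \<in> I\<rbrakk> \<Longrightarrow> K x z y = K x y z"
  by (intro set_mult_commute_subset H_subset)

lemma H_le_K:
  assumes "x \<in> I" "y \<in> I" "z \<in> I"
  shows "H x y \<subseteq> K x y z" "H x z \<subseteq> K x y z"
  using subgroup_set_mult_upper[OF H_subgroup H_subgroup] assms by simp_all

lemma K_diag:
  assumes "x \<in> I" "y \<in> I"
  shows "K x x y = H x y" "K x y x = H x y" "K x y y = H x y"
proof -
  have "H x y \<subseteq> carrier G" using assms by (rule H_subset)
  then show "K x x y = H x y"
    using assms by (force simp: H_diag set_mult_def)
  then show "K x y x = H x y"
    using assms by (simp add: K_commute)
  show "K x y y = H x y"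
    using assms by (simp add: H_subgroup set_mult_subgroup_idem subgroup_incl)
qed

lemma \<beta>_carrier: "\<lbrakk>x \<in> I; y \<in> I; g \<in> carrier G\<rbrakk> \<Longrightarrow> \<beta> x y g \<in> carrier G"
  by (rule hom_in_carrier[OF \<beta>_hom])

lemma \<beta>_mult: "\<lbrakk>x \<in> I; y \<in> I; g \<in> carrier G; h \<in> carrier G\<rbrakk> \<Longrightarrow> \<beta> x y (g \<otimes> h) = \<beta> x y g \<otimes> \<beta> x y h"
  by (rule hom_mult[OF \<beta>_hom])

lemma \<beta>_group_hom: "\<lbrakk>x \<in> I; y \<in> I\<rbrakk> \<Longrightarrow> group_hom G G (\<beta> x y)"
  by (intro group_hom.intro group_hom_axioms.intro \<beta>_hom is_group)

lemma \<beta>_one: "\<lbrakk>x \<in> I; y \<in> I\<rbrakk> \<Longrightarrow> \<beta> x y \<one> = \<one>"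
  by (rule group_hom.hom_one[OF \<beta>_group_hom])

lemma \<beta>_inv: "\<lbrakk>x \<in> I; y \<in> I; g \<in> carrier G\<rbrakk> \<Longrightarrow> \<beta> x y (inv g) = inv (\<beta> x y g)"
  by (rule group_hom.hom_inv[OF \<beta>_group_hom])

text \<open>Puts degenerate and general positions of the indices under one modulus: \<open>h\<close>
  is unmoved if \<open>x = y\<close>, trivial if \<open>x = z\<close>, sent into
  \<open>H y x\<close> if \<open>y = z\<close>, and sent into \<open>H y z\<close>
  otherwise.\<close>

lemma \<beta>_H_le_K:
  assumes "x \<in> I" "y \<in> I" "z \<in> I" "h \<in> H x z"
  shows "\<beta> x y h \<in> K y x z"
proof -
  have h: "h \<in> carrier G" using assms H_subset by blast
  consider "x = y" | "x = z" | "y = z" | "distinct [x, y, z]" by auto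
  then show ?thesis
  proof cases
    case 1 then show ?thesis using assms h by (simp add: \<beta>_diag K_diag)
  next
    case 2 then show ?thesis
      using assms K_subgroup[of y x x] by (simp add: H_diag \<beta>_one subgroup.one_closed)
  next
    case 3 then show ?thesis using assms \<beta>_H_own by (simp add: K_diag)
  next
    case 4 then show ?thesis using assms \<beta>_H_other H_le_K by blast
  qed
qed

lemma \<beta>_K:
  assumes "x \<in> I" "y \<in> I" "z \<in> I" "h \<in> K x y z"
  shows "\<beta> x y h \<in> K y x z"
proof -
  obtain a b where ab: "a \<in> H x y" "b \<in> H x z" "h = a \<otimes> b"
    using assms(4) by (auto simp: set_mult_def)
  then have "a \<in> carrier G" "b \<in> carrier G" using assms H_subset by blast+
  then have "\<beta> x y h = \<beta> x y a \<otimes> \<beta> x y b"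
    using assms ab(3) by (simp add: \<beta>_mult)
  moreover have "\<beta> x y a \<in> K y x z" using ab assms \<beta>_H_own H_le_K by blast
  moreover have "\<beta> x y b \<in> K y x z" using ab assms \<beta>_H_le_K by blast
  ultimately show ?thesis using K_subgroup assms by (simp add: subgroup.m_closed)
qed

lemma \<beta>_cmod:
  assumes "x \<in> I" "y \<in> I" "z \<in> I" "cmod (K x y z) a b"
  shows "cmod (K y x z) (\<beta> x y a) (\<beta> x y b)"
proof -
  obtain h where h: "a \<in> carrier G" "b \<in> carrier G" "h \<in> K x y z" "a = b \<otimes> h"
    using assms by (auto simp: cmod_def)
  then have "h \<in> carrier G" using K_subgroup assms by (blast intro: subgroup.mem_carrier)
  then show ?thesis using h assms \<beta>_K cmod_mem K_subgroup by (simp add: \<beta>_mult \<beta>_carrier)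
qed

lemma \<beta>_cmod_iff:
  assumes "x \<in> I" "y \<in> I" "z \<in> I" "a \<in> carrier G" "b \<in> carrier G"
  shows "cmod (K y x z) (\<beta> x y a) (\<beta> x y b) \<longleftrightarrow> cmod (K x y z) a b"
  using \<beta>_cmod[of x y z a b] \<beta>_cmod[of y x z "\<beta> x y a" "\<beta> x y b"] assms
  by (auto simp: \<beta>_inverse)

text \<open>Split \<open>k\<close> along \<open>H z y\<close>, \<open>H z x\<close> and
  \<open>H z w\<close> for a fourth index \<open>w\<close>. On the last component the two routes
  agree exactly by \<open>\<beta>_comp\<close>; both routes send each of the other components into
  \<open>K x y z\<close>, where the difference is invisible.\<close>

lemma \<beta>_triangle:
  assumes "x \<in> I" "y \<in> I" "z \<in> I" "k \<in> carrier G"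
  shows "cmod (K x y z) (\<beta> y x (\<beta> z y k)) (\<beta> z x k)"
proof (cases "distinct [x, y, z]")
  case False
  then have "\<beta> y x (\<beta> z y k) = \<beta> z x k" using assms by (auto simp: \<beta>_diag \<beta>_inverse \<beta>_carrier)
  then show ?thesis using assms by (simp add: cmod_refl K_subgroup \<beta>_carrier)
next
  case True
  obtain w where w: "w \<in> I" "distinct [z, y, x, w]"
    using ex_fourth[of x y z] assms True by auto
  obtain a b d where k: "a \<in> H z y" "b \<in> H z x" "d \<in> H z w" "k = a \<otimes> b \<otimes> d"
    using span[of z y x w k] w assms by auto
  then have c: "a \<in> carrier G" "b \<in> carrier G" "d \<in> carrier G"
    using H_subset assms w by blast+
  have K: "subgroup (K x y z) G" using assms K_subgroup by blast
  have *: "cmod (K x y z) u v" if "u \<in> K x y z" "v \<in> K x y z" for u v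
    using that K by (simp add: cmod_iff_mem subgroup.m_closed subgroup.m_inv_closed subgroup.mem_carrier)
  have d: "distinct [z, y, x]" "distinct [y, z, x]" "distinct [z, x, y]" "distinct [y, x, z]"
    using True by auto
  have "\<beta> y x (\<beta> z y a) \<in> H x z"
    using \<beta>_H_other[OF assms(2,1,3) d(4)] \<beta>_H_own[OF assms(3,2) k(1)] .
  moreover have "\<beta> z x a \<in> H x y"
    using \<beta>_H_other[OF assms(3,1,2) d(3) k(1)] .
  ultimately have "cmod (K x y z) (\<beta> y x (\<beta> z y a)) (\<beta> z x a)"
    using * H_le_K[OF assms(1-3)] by blast
  moreover have "\<beta> y x (\<beta> z y b) \<in> H x y"
    using \<beta>_H_own[OF assms(2,1)] \<beta>_H_other[OF assms(3,2,1) d(1) k(2)] .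
  then have "cmod (K x y z) (\<beta> y x (\<beta> z y b)) (\<beta> z x b)"
    using * \<beta>_H_own[OF assms(3,1) k(2)] H_le_K[OF assms(1-3)] by blast
  moreover have "cmod (K x y z) (\<beta> y x (\<beta> z y d)) (\<beta> z x d)"
    using \<beta>_comp[of z y x w d] k w assms c K by (simp add: cmod_refl \<beta>_carrier)
  ultimately show ?thesis
    unfolding k(4) using assms c by (simp add: \<beta>_mult \<beta>_carrier cmod_mult[OF K])
qed

text \<open>The image of this union of cosets is again one coset, since an element \<open>e\<close>
  of the right side lies in the image of the coset of \<open>\<beta> y x e\<close>. The left side
  has the form in which \<open>phi\<close> extends a map of cosets to unions of cosets.\<close>

lemma union_\<beta>_cosets:
  assumes "x \<in> I" "y \<in> I" "z \<in> I" "a \<in> carrier G"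
  shows "\<Union> {\<beta> x y g <# H y x | g. g \<in> carrier G \<and> g <# H x y \<subseteq> a <# K x y z} = \<beta> x y a <# K y x z"
proof
  show "\<Union> {\<beta> x y g <# H y x | g. g \<in> carrier G \<and> g <# H x y \<subseteq> a <# K x y z} \<subseteq> \<beta> x y a <# K y x z"
  proof (rule Union_least, clarify)
    fix g assume g: "g \<in> carrier G" "g <# H x y \<subseteq> a <# K x y z"
    then have "cmod (K x y z) g a"
      using assms by (simp add: l_coset_subset_iff_cmod H_subgroup K_subgroup H_le_K)
    then have "\<beta> x y g <# H y x \<subseteq> \<beta> x y a <# K y x z"
      using assms g by (simp add: l_coset_subset_iff_cmod H_subgroup K_subgroup H_le_K \<beta>_cmod \<beta>_carrier)
    then show "\<And>e. e \<in> \<beta> x y g <# H y x \<Longrightarrow> e \<in> \<beta> x y a <# K y x z" by blast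
  qed
  show "\<beta> x y a <# K y x z \<subseteq> \<Union> {\<beta> x y g <# H y x | g. g \<in> carrier G \<and> g <# H x y \<subseteq> a <# K x y z}"
  proof
    fix e assume "e \<in> \<beta> x y a <# K y x z"
    then have e: "cmod (K y x z) e (\<beta> x y a)"
      using assms by (simp add: cmod_l_coset K_subgroup \<beta>_carrier)
    then have ec: "e \<in> carrier G" by (rule cmod_carrier)
    from e have "cmod (K x y z) (\<beta> y x e) a"
      using \<beta>_cmod[of y x z] assms by (metis \<beta>_inverse)
    then have "\<beta> y x e <# H x y \<subseteq> a <# K x y z"
      using assms ec by (simp add: l_coset_subset_iff_cmod H_subgroup K_subgroup H_le_K \<beta>_carrier)
    moreover have "e \<in> \<beta> x y (\<beta> y x e) <# H y x"
      using assms ec by (simp add: \<beta>_inverse lcos_self H_subgroup)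
    ultimately show "e \<in> \<Union> {\<beta> x y g <# H y x | g. g \<in> carrier G \<and> g <# H x y \<subseteq> a <# K x y z}"
      using assms ec \<beta>_carrier by blast
  qed
qed

text \<open>The two sides are the moduli of the two bracketings of a triple product along
  \<open>x\<close>, \<open>y\<close>, \<open>z\<close>, \<open>w\<close>. They agree because both
  are generated by \<open>H x y\<close>, \<open>H x z\<close> and \<open>H x w\<close>.\<close>

lemma \<beta>_image_K_set_mult:
  assumes "x \<in> I" "y \<in> I" "z \<in> I" "w \<in> I"
  shows "(\<beta> y x ` K y z w) <#> K x y w = K x y z <#> K x z w" (is "?A = ?B")
proof
  interpret \<beta>: group_hom G G "\<beta> y x"
    using \<beta>_group_hom assms by blast
  have A: "subgroup ?A G"
    using assms by (simp add: mult_subgroups K_subgroup \<beta>.subgroup_img_is_subgroup)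
  have B: "subgroup ?B G"
    using assms by (simp add: mult_subgroups K_subgroup)
  have K: "subgroup (K x y z) G" "subgroup (K x z w) G" "subgroup (K x y w) G" "subgroup (K y z w) G"
    using assms by (simp_all add: K_subgroup)
  have K_A: "K x y w \<subseteq> ?A" "\<beta> y x ` K y z w \<subseteq> ?A"
    by (rule subgroup_set_mult_upper[OF \<beta>.subgroup_img_is_subgroup[OF K(4)] K(3)])+
  have K_B: "K x y z \<subseteq> ?B" "K x z w \<subseteq> ?B"
    by (rule subgroup_set_mult_upper[OF K(1,2)])+
  have H_B: "H x y \<subseteq> ?B" "H x z \<subseteq> ?B" "H x w \<subseteq> ?B"
    using K_B H_le_K[of x y z] H_le_K[of x z w] assms by blast+
  have "\<beta> y x (h \<otimes> k) \<in> ?B" if "h \<in> H y z" "k \<in> H y w" for h k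
  proof -
    have "h \<in> carrier G" "k \<in> carrier G" using that H_subset assms by blast+
    moreover have "\<beta> y x h \<in> ?B"
      using \<beta>_H_le_K[of y x z h] that assms set_mult_subset_subgroup[OF H_B(1,2) B] by blast
    moreover have "\<beta> y x k \<in> ?B"
      using \<beta>_H_le_K[of y x w k] that assms set_mult_subset_subgroup[OF H_B(1,3) B] by blast
    ultimately show ?thesis using B by (simp add: subgroup.m_closed)
  qed
  then have "\<beta> y x ` K y z w \<subseteq> ?B" by (auto simp: set_mult_def)
  then show "?A \<subseteq> ?B"
    by (intro set_mult_subset_subgroup B H_B)
  have H_A: "H x y \<subseteq> ?A" "H x w \<subseteq> ?A" using K_A H_le_K[of x y w] assms by blast+
  have "H x z \<subseteq> ?A"
  proof -
    consider "x = z" | "y = z" | "x = y" | "distinct [x, y, z]" by auto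
    then show ?thesis
    proof cases
      case 1 then show ?thesis using A assms by (simp add: H_diag subgroup.one_closed)
    next
      case 2 then show ?thesis using H_A by simp
    next
      case 3
      have "H x z \<subseteq> K y z w" using 3 H_le_K assms by blast
      moreover have "\<beta> y x h = h" if "h \<in> H x z" for h
        using that 3 assms H_subset \<beta>_diag by blast
      ultimately show ?thesis using K_A by force
    next
      case 4
      show ?thesis
      proof
        fix h assume h: "h \<in> H x z"
        then have "h \<in> carrier G" using H_subset assms by blast
        then have "h = \<beta> y x (\<beta> x y h)" using assms by (simp add: \<beta>_inverse)
        moreover have "\<beta> x y h \<in> K y z w" using \<beta>_H_other[of x y z h] 4 h assms H_le_K by blast
        ultimately show "h \<in> ?A" using K_A by blast
      qed
    qed
  qed
  then show "?B \<subseteq> ?A"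
    by (intro set_mult_subset_subgroup A H_A)
qed

end

section \<open>The shifted structure is a polygroupoid\<close>

lemma pmult_set_iff: "e \<in> pmult_set M X Y \<longleftrightarrow> (\<exists>a\<in>X. \<exists>b\<in>Y. e \<in> pmult M a b)"
  by (auto simp: pmult_set_def)

text \<open>The map \<open>\<phi>\<close> is described on cosets of products of two subgroups; the
  instance \<open>z = x\<close> gives cosets of \<open>H x y\<close>, as \<open>H x x\<close> is
  trivial. The representatives \<open>c\<close> obey the degenerate and swap laws exactly, but
  rotation only up to a modulus, since it moves from one index to another.\<close>

locale shifted_frame = coset_frame G I H \<beta>
  for G :: "('a, 'b) monoid_scheme" (structure) and I :: "'i set" and H and \<beta> +
  fixes \<phi> :: "'i \<Rightarrow> 'i \<Rightarrow> 'a set \<Rightarrow> 'a set" and C :: "'i \<Rightarrow> 'i \<Rightarrow> 'i \<Rightarrow> 'a set"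
    and c :: "'i \<Rightarrow> 'i \<Rightarrow> 'i \<Rightarrow> 'a"
  assumes \<phi>_coset: "\<lbrakk>x \<in> I; y \<in> I; z \<in> I; a \<in> carrier G\<rbrakk> \<Longrightarrow>
      \<phi> x y (a <# (H x y <#> H x z)) = \<beta> x y a <# (H y x <#> H y z)"
    and C_coset: "\<lbrakk>x \<in> I; y \<in> I; z \<in> I\<rbrakk> \<Longrightarrow> C x y z = c x y z <# (H x y <#> H x z)"
    and c_carrier: "\<lbrakk>x \<in> I; y \<in> I; z \<in> I\<rbrakk> \<Longrightarrow> c x y z \<in> carrier G"
    and c_degenerate: "\<lbrakk>x \<in> I; y \<in> I; z \<in> I; \<not> distinct [x, y, z]\<rbrakk> \<Longrightarrow> c x y z = \<one>"
    and c_swap: "\<lbrakk>x \<in> I; y \<in> I; z \<in> I\<rbrakk> \<Longrightarrow> c x z y = inv (c x y z)"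
    and c_rotate: "\<lbrakk>x \<in> I; y \<in> I; z \<in> I\<rbrakk> \<Longrightarrow> cmod (H y x <#> H y z) (\<beta> x y (c x y z)) (c y z x)"
begin

section \<open>Products and inverses computed on representatives\<close>

abbreviation M :: "('i \<times> 'a set \<times> 'i) poly_structure" where
  "M \<equiv> coset_structure G I H \<phi> C"

lemma carrier_M: "carrier M = {(x, g <# H x y, y) | x g y. x \<in> I \<and> y \<in> I \<and> g \<in> carrier G}"
  by (auto simp: coset_structure_def LCOSETS_def)

lemma in_carrier_M: "\<lbrakk>x \<in> I; y \<in> I; g \<in> carrier G\<rbrakk> \<Longrightarrow> (x, g <# H x y, y) \<in> carrier M"
  by (auto simp: carrier_M)

lemma pidents_M: "pidents M = {(x, \<one> <# H x x, x) | x. x \<in> I}"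
  by (auto simp: coset_structure_def H_diag l_coset_def)

lemma pmult_empty: "y \<noteq> w \<Longrightarrow> pmult M (x, g, y) (w, h, z) = {}"
  by (simp add: coset_structure_def)

lemma pmult_ends: "(x', k, z') \<in> pmult M (x, g, y) (w, h, z) \<Longrightarrow> x' = x \<and> z' = z \<and> y = w"
  by (auto simp: coset_structure_def split: if_splits)

lemma \<phi>_coset_single:
  assumes "x \<in> I" "y \<in> I" "a \<in> carrier G"
  shows "\<phi> x y (a <# H x y) = \<beta> x y a <# H y x"
  using \<phi>_coset[of x y x a] assms by (simp add: K_diag)

lemma pinv_coset:
  assumes "x \<in> I" "y \<in> I" "g \<in> carrier G"
  shows "pinv M (x, g <# H x y, y) = (y, inv (\<beta> x y g) <# H y x, x)"
  using assms
  by (simp add: coset_structure_def set_inv_l_coset H_subgroup \<phi>_coset_single \<beta>_inv)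

text \<open>Moving \<open>a\<close> to \<open>y\<close>, multiplying by \<open>b\<close> and moving
  back gives a coset of \<open>K x y z\<close>. The shift is a coset of the same subgroup, so
  multiplying by it leaves the modulus unchanged.\<close>

lemma pmult_coset:
  assumes "x \<in> I" "y \<in> I" "z \<in> I" "a \<in> carrier G" "b \<in> carrier G"
  shows "pmult M (x, a <# H x y, y) (y, b <# H y z, z) =
    {(x, d <# H x z, z) | d. cmod (K x y z) d (a \<otimes> \<beta> y x b \<otimes> c x y z)}"
proof -
  have "\<phi> y x (\<phi> x y (a <# H x y) <#> (b <# H y z)) = \<phi> y x ((\<beta> x y a \<otimes> b) <# K y x z)"
    using assms by (simp add: \<phi>_coset_single l_coset_set_mult_l_coset H_subgroup \<beta>_carrier)
  also have "\<dots> = (a \<otimes> \<beta> y x b) <# K x y z"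
    using assms by (simp add: \<phi>_coset \<beta>_carrier \<beta>_mult \<beta>_inverse)
  finally have X: "\<phi> y x (\<phi> x y (a <# H x y) <#> (b <# H y z)) <#> C x y z =
      (a \<otimes> \<beta> y x b \<otimes> c x y z) <# K x y z"
    using assms
    by (simp add: C_coset l_coset_set_mult_l_coset K_subgroup \<beta>_carrier c_carrier
        set_mult_subgroup_idem subgroup_incl)
  have P: "d <# H x z \<subseteq> (a \<otimes> \<beta> y x b \<otimes> c x y z) <# K x y z \<longleftrightarrow>
      cmod (K x y z) d (a \<otimes> \<beta> y x b \<otimes> c x y z)" if "d \<in> carrier G" for d
    using assms that
    by (simp add: l_coset_subset_iff_cmod H_subgroup K_subgroup H_le_K \<beta>_carrier c_carrier)
  have "{(x, k, z) | k. k \<in> lcosets (H x z) \<and> k \<subseteq> X} = {(x, d <# H x z, z) | d. P d}"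
    if "\<And>d. d \<in> carrier G \<Longrightarrow> d <# H x z \<subseteq> X \<longleftrightarrow> P d" "\<And>d. P d \<Longrightarrow> d \<in> carrier G" for X P
    using that by (auto simp: LCOSETS_def) blast
  from this[of "(a \<otimes> \<beta> y x b \<otimes> c x y z) <# K x y z" "\<lambda>d. cmod (K x y z) d (a \<otimes> \<beta> y x b \<otimes> c x y z)"]
  show ?thesis
    using P cmod_carrier(1) by (simp add: coset_structure_def X)
qed

text \<open>The criterion does not depend on the representative \<open>d\<close>, because
  \<open>H x z\<close> lies in the modulus \<open>K x y z\<close>.\<close>

lemma mem_pmult:
  assumes "x \<in> I" "y \<in> I" "z \<in> I" "a \<in> carrier G" "b \<in> carrier G" "d \<in> carrier G"
  shows "(x, d <# H x z, z) \<in> pmult M (x, a <# H x y, y) (y, b <# H y z, z) \<longleftrightarrow>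
    cmod (K x y z) d (a \<otimes> \<beta> y x b \<otimes> c x y z)"
proof -
  have K: "subgroup (K x y z) G" using assms K_subgroup by simp
  have "cmod (K x y z) d e" if "d <# H x z = e <# H x z" "e \<in> carrier G" for e
    using that assms H_le_K(2)[of x y z]
    by (auto simp: l_coset_eq_iff_cmod H_subgroup intro: cmod_mono)
  then show ?thesis
    unfolding pmult_coset[OF assms(1-5)]
    using cmod_trans[OF K] cmod_carrier by blast
qed

lemma pmult_cases:
  assumes "x \<in> I" "y \<in> I" "z \<in> I" "a \<in> carrier G" "b \<in> carrier G"
    and "e \<in> pmult M (x, a <# H x y, y) (y, b <# H y z, z)"
  obtains d where "d \<in> carrier G" "e = (x, d <# H x z, z)"
    "cmod (K x y z) d (a \<otimes> \<beta> y x b \<otimes> c x y z)"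
  using assms(6) unfolding pmult_coset[OF assms(1-5)] using cmod_carrier by blast

section \<open>The cocycle condition and associativity\<close>

lemma c_rotate_back:
  assumes "x \<in> I" "y \<in> I" "z \<in> I"
  shows "cmod (K x y z) (\<beta> y x (c y z x)) (c x y z)"
  using \<beta>_cmod[OF assms(2,1,3) c_rotate[OF assms]] assms
  by (simp add: \<beta>_inverse c_carrier cmod_sym K_subgroup)

text \<open>For four distinct indices the modulus is the whole group by \<open>span\<close>.
  Otherwise two indices coincide and the degenerate and swap laws make both sides equal, except that
  \<open>x = z\<close> and \<open>x = w\<close> also use rotation back to \<open>x\<close>.\<close>

lemma c_cocycle:
  assumes "x \<in> I" "y \<in> I" "z \<in> I" "w \<in> I"
  shows "cmod (K x y z <#> K x z w) (c x y z \<otimes> c x z w) (c x y w \<otimes> \<beta> y x (c y z w))"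
    (is "cmod ?T ?a ?b")
proof -
  have T: "subgroup ?T G" using assms by (simp add: K_subgroup mult_subgroups)
  have KT: "K x y z \<subseteq> ?T" "K x z w \<subseteq> ?T"
    by (rule subgroup_set_mult_upper[OF K_subgroup K_subgroup]; fact)+
  have ab: "?a \<in> carrier G" "?b \<in> carrier G" using assms by (simp_all add: c_carrier \<beta>_carrier)
  have eq: "cmod ?T ?a ?b" if "?a = ?b" using that cmod_refl[OF T ab(1)] by simp
  consider "x = y" | "y = z" | "z = w" | "x = z" | "y = w" | "x = w" | "distinct [x, y, z, w]"
    by auto
  then show ?thesis
  proof cases
    case 1 then show ?thesis using assms by (intro eq) (simp add: c_degenerate \<beta>_diag c_carrier)
  next
    case 2 then show ?thesis using assms by (intro eq) (simp add: c_degenerate \<beta>_one c_carrier)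
  next
    case 3 then show ?thesis using assms by (intro eq) (simp add: c_degenerate \<beta>_one c_carrier)
  next
    case 4
    \<comment> \<open>Rotation is known modulo \<open>K x y w\<close>, which is visibly a factor
      only in the other form of the modulus given by
      \<open>\<beta>_image_K_set_mult\<close>.\<close>
    have "K x y w \<subseteq> ?T"
      using \<beta>_image_K_set_mult[of x y z w] subgroup_set_mult_upper(2)[OF
          group_hom.subgroup_img_is_subgroup[OF \<beta>_group_hom K_subgroup] K_subgroup] assms by metis
    then have "cmod ?T (\<beta> y x (c y w x)) (c x y w)"
      using c_rotate_back[of x y w] assms by (blast intro: cmod_mono)
    then have "cmod ?T (c x y w) (\<beta> y x (c y w x))" by (rule cmod_sym[OF T])
    then have "c x y w \<otimes> inv (\<beta> y x (c y w x)) \<in> ?T"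
      using assms by (simp add: cmod_iff_mem[OF T] \<beta>_carrier c_carrier)
    moreover have "?b = c x y w \<otimes> inv (\<beta> y x (c y w x))"
      using assms 4 c_swap[of y w x] by (simp add: \<beta>_inv c_carrier)
    ultimately have "?b \<in> ?T" by simp
    moreover have "?a = \<one>" using 4 assms by (simp add: c_degenerate)
    ultimately show ?thesis
      using cmod_sym[OF T] cmod_mem[OF T, of ?b \<one>] ab(2) by (simp only: one_closed l_one)
  next
    case 5 then show ?thesis using assms c_swap[of x y z]
      by (intro eq) (simp add: c_degenerate \<beta>_one c_carrier)
  next
    case 6
    have "cmod ?T (\<beta> y x (c y z x)) (c x y z)"
      using c_rotate_back[of x y z] assms KT by (blast intro: cmod_mono)
    then show ?thesis
      using 6 assms cmod_sym[OF T] by (simp add: c_degenerate c_carrier \<beta>_carrier)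
  next
    case 7
    have "?T = carrier G"
    proof (intro equalityI subgroup.subset T subsetI)
      fix g assume "g \<in> carrier G"
      then obtain a b d where "a \<in> H x y" "b \<in> H x z" "d \<in> H x w" "g = a \<otimes> b \<otimes> d"
        using span[of x y z w g] assms 7 by auto
      moreover have "H x w \<subseteq> K x z w" using H_le_K assms by blast
      ultimately show "g \<in> ?T" by (auto intro!: set_multI)
    qed
    then show ?thesis using ab cmod_iff_mem[OF T ab] by simp
  qed
qed

text \<open>Once the intermediate elements are eliminated, both sides are congruences for
  \<open>d\<close> with the same modulus. Their right-hand sides agree by
  \<open>\<beta>_triangle\<close> for the transports of \<open>k\<close> and by
  \<open>c_cocycle\<close> for the shifts.\<close>

lemma shifted_assoc:
  assumes "x \<in> I" "y \<in> I" "z \<in> I" "w \<in> I"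
    and "a \<in> carrier G" "b \<in> carrier G" "k \<in> carrier G" "d \<in> carrier G"
  shows "(\<exists>l\<in>carrier G. cmod (K x y z) l (a \<otimes> \<beta> y x b \<otimes> c x y z) \<and>
      cmod (K x z w) d (l \<otimes> \<beta> z x k \<otimes> c x z w)) \<longleftrightarrow>
    (\<exists>m\<in>carrier G. cmod (K y z w) m (b \<otimes> \<beta> z y k \<otimes> c y z w) \<and>
      cmod (K x y w) d (a \<otimes> \<beta> y x m \<otimes> c x y w))" (is "?L \<longleftrightarrow> ?R")
proof -
  let ?T = "K x y z <#> K x z w"
  have T: "subgroup ?T G" using assms by (simp add: K_subgroup mult_subgroups)
  have KT: "K x y z \<subseteq> ?T"
    by (rule subgroup_set_mult_upper[OF K_subgroup K_subgroup]; fact)+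
  note [simp] = assms \<beta>_carrier c_carrier
  let ?A = "\<beta> z x k \<otimes> c x z w" and ?B = "a \<otimes> \<beta> y x b \<otimes> c x y z"
  let ?A' = "a \<otimes> c x y w" and ?B' = "b \<otimes> \<beta> z y k \<otimes> c y z w"
  \<comment> \<open>On this side the intermediate element already lives at \<open>x\<close>, so
    \<open>cmod_compose\<close> is used with \<open>id\<close>; on the other side it lives at
    \<open>y\<close> and is moved by \<open>\<beta> y x\<close>.\<close>
  have "?L \<longleftrightarrow> (\<exists>l\<in>carrier G. cmod (K x y z) l ?B \<and> cmod (K x z w) d (?A \<otimes> id l))"
    by (intro bex_cong refl) (simp add: m_ac)
  also have "\<dots> \<longleftrightarrow> cmod ?T d (?A \<otimes> ?B)"
    using cmod_compose[of "K x y z" "K x z w" id ?A ?B d] by (simp add: K_subgroup hom_def)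
  finally have L: "?L \<longleftrightarrow> cmod ?T d (?A \<otimes> ?B)" .
  have "?R \<longleftrightarrow> (\<exists>m\<in>carrier G. cmod (K y z w) m ?B' \<and> cmod (K x y w) d (?A' \<otimes> \<beta> y x m))"
    by (intro bex_cong refl) (simp add: m_ac)
  also have "\<dots> \<longleftrightarrow> cmod ?T d (?A' \<otimes> \<beta> y x ?B')"
    using cmod_compose[of "K y z w" "K x y w" "\<beta> y x" ?A' ?B' d] \<beta>_image_K_set_mult[of x y z w]
    by (simp add: K_subgroup \<beta>_hom)
  finally have R: "?R \<longleftrightarrow> cmod ?T d (?A' \<otimes> \<beta> y x ?B')" .
  have "cmod ?T (\<beta> y x (\<beta> z y k)) (\<beta> z x k)"
    using \<beta>_triangle[of x y z k] KT by (auto intro: cmod_mono)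
  then have "cmod ?T (\<beta> z x k) (\<beta> y x (\<beta> z y k))" by (rule cmod_sym[OF T])
  then have "cmod ?T ((a \<otimes> \<beta> y x b) \<otimes> (\<beta> z x k \<otimes> (c x y z \<otimes> c x z w)))
      ((a \<otimes> \<beta> y x b) \<otimes> (\<beta> y x (\<beta> z y k) \<otimes> (c x y w \<otimes> \<beta> y x (c y z w))))"
    by (intro cmod_mult T cmod_refl c_cocycle) simp_all
  moreover have "(a \<otimes> \<beta> y x b) \<otimes> (\<beta> z x k \<otimes> (c x y z \<otimes> c x z w)) = ?A \<otimes> ?B"
    by (simp add: m_ac)
  moreover have "(a \<otimes> \<beta> y x b) \<otimes> (\<beta> y x (\<beta> z y k) \<otimes> (c x y w \<otimes> \<beta> y x (c y z w))) = ?A' \<otimes> \<beta> y x ?B'"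
    by (simp add: m_ac \<beta>_mult)
  ultimately show ?thesis
    unfolding L R using cmod_trans[OF T] cmod_sym[OF T] by metis
qed

lemma pmult_set_left:
  assumes "x \<in> I" "y \<in> I" "z \<in> I" "w \<in> I" "a \<in> carrier G" "b \<in> carrier G" "k \<in> carrier G"
  shows "pmult_set M (pmult M (x, a <# H x y, y) (y, b <# H y z, z)) {(z, k <# H z w, w)} =
    {(x, d <# H x w, w) | d. d \<in> carrier G \<and>
      (\<exists>l\<in>carrier G. cmod (K x y z) l (a \<otimes> \<beta> y x b \<otimes> c x y z) \<and>
        cmod (K x z w) d (l \<otimes> \<beta> z x k \<otimes> c x z w))}" (is "?L = ?R")
proof
  show "?L \<subseteq> ?R"
  proof
    fix u assume "u \<in> ?L"
    then obtain e where e: "e \<in> pmult M (x, a <# H x y, y) (y, b <# H y z, z)"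
      "u \<in> pmult M e (z, k <# H z w, w)" by (auto simp: pmult_set_iff)
    obtain l where l: "l \<in> carrier G" "e = (x, l <# H x z, z)"
      "cmod (K x y z) l (a \<otimes> \<beta> y x b \<otimes> c x y z)"
      using assms e(1) by (elim pmult_cases[rotated 5])
    obtain d where "d \<in> carrier G" "u = (x, d <# H x w, w)" "cmod (K x z w) d (l \<otimes> \<beta> z x k \<otimes> c x z w)"
      using assms l(1) e(2)[unfolded l(2)] by (elim pmult_cases[rotated 5])
    with l show "u \<in> ?R" by blast
  qed
  show "?R \<subseteq> ?L"
    using assms by (auto simp: pmult_set_iff intro!: bexI[OF _ mem_pmult[THEN iffD2]] mem_pmult[THEN iffD2])
qed

lemma pmult_set_right:
  assumes "x \<in> I" "y \<in> I" "z \<in> I" "w \<in> I" "a \<in> carrier G" "b \<in> carrier G" "k \<in> carrier G"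
  shows "pmult_set M {(x, a <# H x y, y)} (pmult M (y, b <# H y z, z) (z, k <# H z w, w)) =
    {(x, d <# H x w, w) | d. d \<in> carrier G \<and>
      (\<exists>m\<in>carrier G. cmod (K y z w) m (b \<otimes> \<beta> z y k \<otimes> c y z w) \<and>
        cmod (K x y w) d (a \<otimes> \<beta> y x m \<otimes> c x y w))}" (is "?L = ?R")
proof
  show "?L \<subseteq> ?R"
  proof
    fix u assume "u \<in> ?L"
    then obtain e where e: "e \<in> pmult M (y, b <# H y z, z) (z, k <# H z w, w)"
      "u \<in> pmult M (x, a <# H x y, y) e" by (auto simp: pmult_set_iff)
    obtain l where l: "l \<in> carrier G" "e = (y, l <# H y w, w)"
      "cmod (K y z w) l (b \<otimes> \<beta> z y k \<otimes> c y z w)"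
      using assms e(1) by (elim pmult_cases[rotated 5])
    obtain d where "d \<in> carrier G" "u = (x, d <# H x w, w)" "cmod (K x y w) d (a \<otimes> \<beta> y x l \<otimes> c x y w)"
      using assms l(1) e(2)[unfolded l(2)] by (elim pmult_cases[rotated 5])
    with l show "u \<in> ?R" by blast
  qed
  show "?R \<subseteq> ?L"
    using assms by (auto simp: pmult_set_iff intro!: bexI[OF _ mem_pmult[THEN iffD2]] mem_pmult[THEN iffD2])
qed

lemma pmult_set_assoc:
  assumes "A \<in> carrier M" "B \<in> carrier M" "E \<in> carrier M"
  shows "pmult_set M (pmult M A B) {E} = pmult_set M {A} (pmult M B E)"
proof -
  obtain x a y where A: "A = (x, a <# H x y, y)" "x \<in> I" "y \<in> I" "a \<in> carrier G"
    using assms(1) by (auto simp: carrier_M)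
  obtain y' b z where B: "B = (y', b <# H y' z, z)" "y' \<in> I" "z \<in> I" "b \<in> carrier G"
    using assms(2) by (auto simp: carrier_M)
  obtain z' k w where E: "E = (z', k <# H z' w, w)" "z' \<in> I" "w \<in> I" "k \<in> carrier G"
    using assms(3) by (auto simp: carrier_M)
  show ?thesis
  proof (cases "y = y' \<and> z = z'")
    case True
    have "pmult_set M (pmult M A B) {E} = pmult_set M {A} (pmult M B E) \<longleftrightarrow>
      {(x, d <# H x w, w) | d. d \<in> carrier G \<and>
      (\<exists>l\<in>carrier G. cmod (K x y z) l (a \<otimes> \<beta> y x b \<otimes> c x y z) \<and>
        cmod (K x z w) d (l \<otimes> \<beta> z x k \<otimes> c x z w))} =
      {(x, d <# H x w, w) | d. d \<in> carrier G \<and>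
      (\<exists>m\<in>carrier G. cmod (K y z w) m (b \<otimes> \<beta> z y k \<otimes> c y z w) \<and>
        cmod (K x y w) d (a \<otimes> \<beta> y x m \<otimes> c x y w))}"
      using True A B E by (simp only: pmult_set_left pmult_set_right)
    then show ?thesis
      by (rule iffD2) (use shifted_assoc[OF A(2,3) B(3) E(3) A(4) B(4) E(4)] in blast)
  next
    case False
    have "u \<notin> pmult_set M (pmult M A B) {E}" "u \<notin> pmult_set M {A} (pmult M B E)" for u
      using False A(1) B(1) E(1) pmult_ends
      by (cases u; fastforce simp: pmult_set_iff)+
    then show ?thesis by blast
  qed
qed

section \<open>Identities and cycle laws\<close>

text \<open>Only the identity at the matching index contributes. With two equal adjacent indices the
  shift is trivial and the modulus shrinks to \<open>H x y\<close>, which leaves just the coset of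
  \<open>a\<close>.\<close>

lemma pmult_set_pidents:
  assumes "A \<in> carrier M"
  shows "pmult_set M {A} (pidents M) = {A}" "pmult_set M (pidents M) {A} = {A}"
proof -
  obtain x a y where A: "A = (x, a <# H x y, y)" "x \<in> I" "y \<in> I" "a \<in> carrier G"
    using assms by (auto simp: carrier_M)
  have *: "{(x, d <# H x y, y) | d. cmod (H x y) d a} = {A}"
    using l_coset_eq_iff_cmod[OF H_subgroup[OF A(2,3)] _ A(4)] cmod_carrier(1)
      cmod_refl[OF H_subgroup[OF A(2,3)] A(4)] by (auto simp: A(1))
  have UN_single: "(\<Union>z\<in>I. f z) = f y" if "y \<in> I" "\<And>z. z \<noteq> y \<Longrightarrow> f z = {}"
    for f :: "'i \<Rightarrow> ('i \<times> 'a set \<times> 'i) set" and y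
    using that by auto (metis emptyE)
  have "pmult_set M {A} (pidents M) = (\<Union>z\<in>I. pmult M A (z, \<one> <# H z z, z))"
    by (auto simp: pmult_set_def pidents_M)
  also have "\<dots> = pmult M A (y, \<one> <# H y y, y)"
    unfolding A(1) by (rule UN_single[OF A(3) pmult_empty]) simp
  also have "\<dots> = {A}"
    using A * by (simp add: pmult_coset \<beta>_one c_degenerate K_diag)
  finally show "pmult_set M {A} (pidents M) = {A}" .
  have "pmult_set M (pidents M) {A} = (\<Union>z\<in>I. pmult M (z, \<one> <# H z z, z) A)"
    by (auto simp: pmult_set_def pidents_M)
  also have "\<dots> = pmult M (x, \<one> <# H x x, x) A"
    unfolding A(1) by (rule UN_single[OF A(2) pmult_empty])
  also have "\<dots> = {A}"
    using A * by (simp add: pmult_coset \<beta>_diag c_degenerate K_diag)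
  finally show "pmult_set M (pidents M) {A} = {A}" .
qed

text \<open>When the endpoints match, all three memberships express the congruence of
  \<open>d\<close> with \<open>a \<otimes> \<beta> y x b \<otimes> c x y z\<close>, solved for
  \<open>d\<close>, for \<open>a\<close> and for \<open>b\<close>. When they do not match, all three
  fail.\<close>

lemma pmult_cycle:
  assumes "A \<in> carrier M" "B \<in> carrier M" "E \<in> carrier M"
  shows "A \<in> pmult M B E \<longleftrightarrow> B \<in> pmult M A (pinv M E)" (is ?right)
    and "A \<in> pmult M B E \<longleftrightarrow> E \<in> pmult M (pinv M B) A" (is ?left)
proof -
  obtain x d z where A: "A = (x, d <# H x z, z)" "x \<in> I" "z \<in> I" "d \<in> carrier G"
    using assms(1) by (auto simp: carrier_M)
  obtain x' a y where B: "B = (x', a <# H x' y, y)" "x' \<in> I" "y \<in> I" "a \<in> carrier G"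
    using assms(2) by (auto simp: carrier_M)
  obtain y' b z' where E: "E = (y', b <# H y' z', z')" "y' \<in> I" "z' \<in> I" "b \<in> carrier G"
    using assms(3) by (auto simp: carrier_M)
  have "?right \<and> ?left"
  proof (cases "x = x' \<and> y = y' \<and> z = z'")
    case False
    then show ?thesis
      using A B E pmult_ends by (fastforce simp: pinv_coset)
  next
    case True
    note [simp] = A B E \<beta>_carrier c_carrier
    have K: "subgroup (K x y z) G" using A B by (intro K_subgroup)
    have m: "A \<in> pmult M B E \<longleftrightarrow> cmod (K x y z) d (a \<otimes> \<beta> y x b \<otimes> c x y z)"
      using True by (simp add: mem_pmult)
    have tri: "cmod (K x y z) (\<beta> z x (\<beta> y z b)) (\<beta> y x b)"
      using \<beta>_triangle[of x z y b] True K_commute[of x y z] by simp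
    have "B \<in> pmult M A (pinv M E) \<longleftrightarrow> cmod (K x z y) a (d \<otimes> \<beta> z x (inv (\<beta> y z b)) \<otimes> c x z y)"
      using True by (simp add: pinv_coset mem_pmult)
    also have "\<dots> \<longleftrightarrow> cmod (K x y z) a (d \<otimes> inv (\<beta> z x (\<beta> y z b)) \<otimes> inv (c x y z))"
      using True c_swap[of x y z] K_commute[of x y z] by (simp add: \<beta>_inv)
    also have "\<dots> \<longleftrightarrow> cmod (K x y z) d (a \<otimes> \<beta> y x b \<otimes> c x y z)"
      by (rule cmod_solve[symmetric]) (use True tri K in \<open>simp_all add: cmod_refl\<close>)
    finally have r: ?right using m by blast
    have "E \<in> pmult M (pinv M B) A \<longleftrightarrow> cmod (K y x z) b (inv (\<beta> x y a) \<otimes> \<beta> x y d \<otimes> c y x z)"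
      using True by (simp add: pinv_coset mem_pmult)
    \<comment> \<open>This condition lives in the group at \<open>y\<close>; applying
      \<open>\<beta> y x\<close> makes it comparable with the one at \<open>x\<close>.\<close>
    also have "\<dots> \<longleftrightarrow> cmod (K x y z) (\<beta> y x b) (\<beta> y x (inv (\<beta> x y a) \<otimes> \<beta> x y d \<otimes> c y x z))"
      using True by (intro \<beta>_cmod_iff[symmetric]) auto
    also have "\<beta> y x (inv (\<beta> x y a) \<otimes> \<beta> x y d \<otimes> c y x z) = d \<otimes> inv a \<otimes> inv (\<beta> y x (c y z x))"
      using True c_swap[of y z x] by (simp add: \<beta>_mult \<beta>_inv \<beta>_inverse m_comm)
    also have "cmod (K x y z) (\<beta> y x b) (d \<otimes> inv a \<otimes> inv (\<beta> y x (c y z x))) \<longleftrightarrow>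
        cmod (K x y z) d (\<beta> y x b \<otimes> a \<otimes> c x y z)"
      by (rule cmod_solve[symmetric])
        (use True K c_rotate_back[of x y z] in \<open>simp_all add: cmod_refl\<close>)
    also have "\<beta> y x b \<otimes> a \<otimes> c x y z = a \<otimes> \<beta> y x b \<otimes> c x y z"
      using True by (simp add: m_comm)
    finally have ?left using m by blast
    with r show ?thesis by blast
  qed
  then show ?right ?left by blast+
qed

theorem polygroupoid_M: "polygroupoid M"
proof
  fix A B assume "A \<in> carrier M" "B \<in> carrier M"
  then obtain x a y y' b z where "A = (x, a <# H x y, y)" "B = (y', b <# H y' z, z)"
    "x \<in> I" "y \<in> I" "z \<in> I" "a \<in> carrier G" "b \<in> carrier G"
    by (auto simp: carrier_M)
  then show "pmult M A B \<subseteq> carrier M"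
    using pmult_cases in_carrier_M pmult_empty by (cases "y = y'") (blast, simp)
next
  show "pidents M \<subseteq> carrier M"
    by (auto simp: pidents_M in_carrier_M)
next
  fix A assume "A \<in> carrier M"
  then obtain x a y where "A = (x, a <# H x y, y)" "x \<in> I" "y \<in> I" "a \<in> carrier G"
    by (auto simp: carrier_M)
  then show "pinv M A \<in> carrier M"
    by (simp add: pinv_coset in_carrier_M \<beta>_carrier)
next
  fix A B E assume "A \<in> carrier M" "B \<in> carrier M" "E \<in> carrier M"
  then show "B \<in> pmult M A (pinv M E) \<longleftrightarrow> E \<in> pmult M (pinv M B) A"
    using pmult_cycle by blast
qed (simp_all only: pmult_set_assoc pmult_set_pidents pmult_cycle(1))

end

section \<open>The shifted structure is not representable\<close>

context coset_frame
begin

text \<open>Serves to carry the modulus of a triangle of outer points back to the centre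
  \<open>p\<close> of a star.\<close>

lemma \<beta>_K_other:
  assumes "{x, y, z, w} \<subseteq> I" "distinct [x, y, z, w]" "h \<in> K x z w"
  shows "\<beta> x y h \<in> K y z w"
proof -
  obtain a b where ab: "a \<in> H x z" "b \<in> H x w" "h = a \<otimes> b"
    using assms(3) by (auto simp: set_mult_def)
  then have "a \<in> carrier G" "b \<in> carrier G" using assms H_subset by blast+
  then have "\<beta> x y h = \<beta> x y a \<otimes> \<beta> x y b" using assms ab by (simp add: \<beta>_mult)
  moreover have "\<beta> x y a \<in> H y z" "\<beta> x y b \<in> H y w"
    using ab assms \<beta>_H_other by auto
  ultimately show ?thesis by (simp add: set_multI)
qed

text \<open>The quotient of \<open>a\<close> and \<open>b\<close> lies both in \<open>H x y\<close>
  and in \<open>K x z w\<close>, hence is trivial by \<open>indep\<close>. This turns congruences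
  between labels into equations.\<close>

lemma cmod_H_eq:
  assumes "{x, y, z, w} \<subseteq> I" "distinct [x, y, z, w]" "a \<in> H x y" "b \<in> H x y" "cmod (K x z w) a b"
  shows "a = b"
proof -
  have c: "a \<in> carrier G" "b \<in> carrier G" using assms H_subset by blast+
  have "a \<otimes> inv b \<in> H x y"
    using assms H_subgroup by (simp add: subgroup.m_closed subgroup.m_inv_closed)
  moreover have "a \<otimes> inv b \<in> K x z w"
    using assms c cmod_iff_mem K_subgroup by simp
  ultimately have "a \<otimes> inv b = \<one>" using indep assms by blast
  then show ?thesis using c by (metis inv_equality inv_inv inv_closed)
qed

text \<open>The transport of \<open>H\<^sub>p\<^sub>z\<close> onto \<open>H\<^sub>p\<^sub>y\<close> inside the group at \<open>p\<close>; in the coset structure of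
  the paper it is \<open>\<alpha>\<close> of the transposition of these two subgroups.\<close>

definition \<tau> :: "'i \<Rightarrow> 'i \<Rightarrow> 'i \<Rightarrow> 'a \<Rightarrow> 'a" where
  "\<tau> p y z h = \<beta> y p (\<beta> z y (\<beta> p z h))"

lemma \<tau>_mem:
  assumes "{p, y, z} \<subseteq> I" "distinct [p, y, z]" "h \<in> H p z"
  shows "\<tau> p y z h \<in> H p y"
proof -
  have "\<beta> p z h \<in> H z p" using assms \<beta>_H_own by simp
  then have "\<beta> z y (\<beta> p z h) \<in> H y p" using assms \<beta>_H_other[of z y p] by auto
  then show ?thesis unfolding \<tau>_def using assms \<beta>_H_own by simp
qed

lemma \<tau>_mult:
  "\<lbrakk>{p, y, z} \<subseteq> I; g \<in> carrier G; h \<in> carrier G\<rbrakk> \<Longrightarrow> \<tau> p y z (g \<otimes> h) = \<tau> p y z g \<otimes> \<tau> p y z h"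
  by (simp add: \<tau>_def \<beta>_mult \<beta>_carrier)

text \<open>The neighbouring maps \<open>\<beta> z p\<close> and \<open>\<beta> p z\<close> cancel.
  What remains moves an element of \<open>H w p\<close> from \<open>w\<close> through
  \<open>z\<close> to \<open>y\<close>, where \<open>\<beta>_comp\<close> applies with
  \<open>p\<close> as the fourth index.\<close>

lemma \<tau>_comp:
  assumes "{p, y, z, w} \<subseteq> I" "distinct [p, y, z, w]" "h \<in> H p w"
  shows "\<tau> p y z (\<tau> p z w h) = \<tau> p y w h"
proof -
  have h: "h \<in> carrier G" using assms H_subset by blast
  have "\<beta> p w h \<in> H w p" using assms \<beta>_H_own by simp
  then have "\<beta> z y (\<beta> w z (\<beta> p w h)) = \<beta> w y (\<beta> p w h)"
    using \<beta>_comp[of w z y p] assms by auto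
  then show ?thesis using h assms by (simp add: \<tau>_def \<beta>_inverse \<beta>_carrier)
qed

end

locale represented_frame = shifted_frame G I H \<beta> \<phi> C c
  for G :: "('a, 'b) monoid_scheme" (structure) and I :: "'i set" and H and \<beta> and \<phi> and C and c +
  fixes U :: "'u set" and rep
  assumes rep: "representation M U rep"
begin

section \<open>Labels of edges in a representation\<close>

lemma rep_nonempty: "A \<in> carrier M \<Longrightarrow> rep A \<noteq> {}"
  and rep_disjoint: "\<lbrakk>A \<in> carrier M; B \<in> carrier M; A \<noteq> B\<rbrakk> \<Longrightarrow> rep A \<inter> rep B = {}"
  and rep_O: "\<lbrakk>A \<in> carrier M; B \<in> carrier M\<rbrakk> \<Longrightarrow> rep A O rep B = (\<Union>E\<in>pmult M A B. rep E)"
  and rep_ident: "A \<in> pidents M \<Longrightarrow> rep A \<subseteq> Id_on U"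
  using rep unfolding representation_def by simp_all

definition rel :: "'i \<Rightarrow> 'i \<Rightarrow> 'a \<Rightarrow> ('u \<times> 'u) set" where
  "rel x y g = rep (x, g <# H x y, y)"

text \<open>Distinct elements have disjoint relations, so an edge with given endpoint indices
  carries at most one coset.\<close>

lemma rel_unique:
  assumes "x \<in> I" "y \<in> I" "a \<in> carrier G" "b \<in> carrier G"
    and "(u, v) \<in> rel x y a" "(u, v) \<in> rel x y b"
  shows "cmod (H x y) a b"
proof -
  have "rep (x, a <# H x y, y) \<inter> rep (x, b <# H x y, y) \<noteq> {}"
    using assms(5,6) unfolding rel_def by blast
  then have "(x, a <# H x y, y) = (x, b <# H x y, y)"
    using rep_disjoint[OF in_carrier_M in_carrier_M, OF assms(1,2,3) assms(1,2,4)] by metis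
  then show ?thesis using l_coset_eq_iff_cmod H_subgroup assms(1-4) by blast
qed

lemma rel_cong:
  assumes "x \<in> I" "y \<in> I" "cmod (H x y) a b"
  shows "rel x y a = rel x y b"
  using l_coset_eq_iff_cmod[OF H_subgroup, THEN iffD2] cmod_carrier[OF assms(3)] assms
  unfolding rel_def by simp

lemma rel_O:
  assumes "x \<in> I" "y \<in> I" "z \<in> I" "a \<in> carrier G" "b \<in> carrier G"
  shows "rel x y a O rel y z b = \<Union> {rel x z d | d. cmod (K x y z) d (a \<otimes> \<beta> y x b \<otimes> c x y z)}"
proof -
  have "rel x y a O rel y z b =
      (\<Union>e\<in>pmult M (x, a <# H x y, y) (y, b <# H y z, z). rep e)"
    unfolding rel_def using assms by (intro rep_O in_carrier_M)
  then show ?thesis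
    unfolding pmult_coset[OF assms] rel_def by blast
qed

text \<open>Composition yields some label \<open>e\<close> on the third edge that satisfies the
  congruence. By uniqueness \<open>d\<close> and \<open>e\<close> differ only by an element of
  \<open>H x z\<close>, which the modulus absorbs.\<close>

lemma rel_triangle:
  assumes "x \<in> I" "y \<in> I" "z \<in> I" "a \<in> carrier G" "b \<in> carrier G" "d \<in> carrier G"
    and "(u, v) \<in> rel x y a" "(v, w) \<in> rel y z b" "(u, w) \<in> rel x z d"
  shows "cmod (K x y z) d (a \<otimes> \<beta> y x b \<otimes> c x y z)"
proof -
  obtain e where e: "(u, w) \<in> rel x z e" "cmod (K x y z) e (a \<otimes> \<beta> y x b \<otimes> c x y z)"
    using rel_O[OF assms(1-5)] assms(7,8) by blast
  then have "cmod (H x z) d e"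
    using rel_unique assms cmod_carrier by blast
  then have "cmod (K x y z) d e"
    using H_le_K assms by (blast intro: cmod_mono)
  then show ?thesis using e cmod_trans K_subgroup assms by blast
qed

section \<open>The star at a point over \<open>p\<close> and its outer triangles\<close>

text \<open>The identity at \<open>p\<close> is represented by a nonempty part of the diagonal,
  which provides \<open>u\<close>. It belongs to the product of the trivial cosets along
  \<open>p\<close>, \<open>y\<close>, \<open>p\<close>, so the loop at \<open>u\<close> factors
  through a point \<open>v y\<close>.\<close>

lemma star_points:
  assumes "p \<in> I"
  obtains u v where "\<And>y. y \<in> I \<Longrightarrow> (u, v y) \<in> rel p y \<one>" "\<And>y. y \<in> I \<Longrightarrow> (v y, u) \<in> rel y p \<one>"
proof -
  have "(p, \<one> <# H p p, p) \<in> pidents M" using assms by (auto simp: pidents_M)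
  moreover have "(p, \<one> <# H p p, p) \<in> carrier M" using assms in_carrier_M by blast
  ultimately have "rel p p \<one> \<noteq> {}" "rel p p \<one> \<subseteq> Id_on U"
    unfolding rel_def by (simp_all only: rep_nonempty rep_ident not_False_eq_True)
  then obtain u where u: "(u, u) \<in> rel p p \<one>" by blast
  have "\<exists>v. (u, v) \<in> rel p y \<one> \<and> (v, u) \<in> rel y p \<one>" if "y \<in> I" for y
  proof -
    have "cmod (K p y p) \<one> (\<one> \<otimes> \<beta> y p \<one> \<otimes> c p y p)"
      using that assms by (simp add: \<beta>_one c_degenerate cmod_refl K_subgroup)
    then have "(u, u) \<in> rel p y \<one> O rel y p \<one>"
      using u rel_O[of p y p \<one> \<one>] that assms by blast
    then show ?thesis by blast
  qed
  then obtain v where "\<forall>y\<in>I. (u, v y) \<in> rel p y \<one> \<and> (v y, u) \<in> rel y p \<one>" by metis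
  then show thesis using that by blast
qed

text \<open>The triangle at \<open>p\<close>, \<open>y\<close>, \<open>z\<close> fixes the label up
  to a factor from \<open>H p y\<close> and one from \<open>H p z\<close>. The latter is carried by
  \<open>\<beta> p y\<close> into \<open>H y z\<close> and so does not change the coset; only
  \<open>h\<close> remains free.\<close>

lemma star_label:
  assumes "{p, y, z} \<subseteq> I" "distinct [p, y, z]"
    and "(u, v) \<in> rel p y \<one>" "(v, u) \<in> rel y p \<one>" "(u, w) \<in> rel p z \<one>"
  obtains h where "h \<in> H p y" "(v, w) \<in> rel y z (\<beta> p y (inv (c p y z) \<otimes> h))"
proof -
  have I: "p \<in> I" "y \<in> I" "z \<in> I" using assms by auto
  \<comment> \<open>Both edges of the path from \<open>v\<close> through \<open>u\<close> to
    \<open>w\<close> carry trivial cosets, and their composite supplies a label for the edge from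
    \<open>v\<close> to \<open>w\<close>.\<close>
  obtain g where g: "(v, w) \<in> rel y z g" "g \<in> carrier G"
    using rel_O[of y p z \<one> \<one>] I assms(4,5) cmod_carrier(1) by blast
  have "cmod (K p y z) \<one> (\<one> \<otimes> \<beta> y p g \<otimes> c p y z)"
    using rel_triangle[of p y z \<one> g \<one>] I g assms by simp
  then have "cmod (K p y z) (inv (c p y z) \<otimes> \<one>) (inv (c p y z) \<otimes> (\<beta> y p g \<otimes> c p y z))"
    using I g by (subst cmod_cancel) (simp_all add: K_subgroup c_carrier \<beta>_carrier)
  moreover have "inv (c p y z) \<otimes> (\<beta> y p g \<otimes> c p y z) = \<beta> y p g"
    using I g by (simp add: c_carrier \<beta>_carrier m_comm[of "\<beta> y p g"] m_assoc[symmetric])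
  ultimately have "cmod (K p y z) (\<beta> y p g) (inv (c p y z))"
    using I by (simp add: cmod_sym K_subgroup c_carrier)
  then obtain h k where hk: "h \<in> H p y" "k \<in> H p z" "\<beta> y p g = inv (c p y z) \<otimes> (h \<otimes> k)"
    unfolding cmod_def set_mult_def by blast
  have [simp]: "h \<in> carrier G" "k \<in> carrier G" using hk I H_subset by blast+
  have "g = \<beta> p y (\<beta> y p g)" using I g by (simp add: \<beta>_inverse)
  also have "\<dots> = \<beta> p y (inv (c p y z) \<otimes> h) \<otimes> \<beta> p y k"
    unfolding hk(3) using I by (simp add: \<beta>_mult c_carrier m_assoc[symmetric])
  finally have "cmod (H y z) g (\<beta> p y (inv (c p y z) \<otimes> h))"
    using cmod_mem[OF H_subgroup \<beta>_H_other[of p y z k]] hk I assms(2)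
    by (simp add: \<beta>_carrier c_carrier)
  then have "rel y z g = rel y z (\<beta> p y (inv (c p y z) \<otimes> h))"
    using I by (intro rel_cong)
  then show thesis using that hk(1) g(1) by blast
qed

text \<open>The triangle law for three outer points, pulled back to \<open>p\<close>. The assumption
  on \<open>c p z w\<close> clears the middle label, the one on \<open>c y z w\<close> the shift of
  the triangle itself; the shifts in the two labels starting at \<open>y\<close> survive.\<close>

lemma star_triangle:
  assumes "{p, y, z, w} \<subseteq> I" "distinct [p, y, z, w]" "c p z w = \<one>" "c y z w = \<one>"
    and h: "h \<in> H p y" "k \<in> H p z" "l \<in> H p y"
    and "(v, v') \<in> rel y z (\<beta> p y (inv (c p y z) \<otimes> h))"
      "(v', v'') \<in> rel z w (\<beta> p z (inv (c p z w) \<otimes> k))"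
      "(v, v'') \<in> rel y w (\<beta> p y (inv (c p y w) \<otimes> l))"
  shows "cmod (K p z w) (inv (c p y w) \<otimes> l) (inv (c p y z) \<otimes> h \<otimes> \<tau> p y z k)"
proof -
  have I: "p \<in> I" "y \<in> I" "z \<in> I" "w \<in> I" using assms by auto
  have [simp]: "h \<in> carrier G" "k \<in> carrier G" "l \<in> carrier G" using h I H_subset by blast+
  let ?a = "\<beta> p y (inv (c p y w) \<otimes> l)"
    and ?b = "\<beta> p y (inv (c p y z) \<otimes> h) \<otimes> \<beta> z y (\<beta> p z k)"
  have "cmod (K y z w) ?a ?b"
    using rel_triangle[of y z w "\<beta> p y (inv (c p y z) \<otimes> h)" "\<beta> p z k" ?a] I assms
    by (simp add: \<beta>_carrier c_carrier)
  then obtain n where n: "n \<in> K y z w" "?a = ?b \<otimes> n" by (auto simp: cmod_def)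
  have [simp]: "n \<in> carrier G" using n K_subgroup I by (blast intro: subgroup.mem_carrier)
  have "inv (c p y w) \<otimes> l = \<beta> y p ?a" using I by (simp add: \<beta>_inverse c_carrier)
  also have "\<dots> = inv (c p y z) \<otimes> h \<otimes> \<tau> p y z k \<otimes> \<beta> y p n"
    unfolding n(2) using I by (simp add: \<beta>_inverse c_carrier \<beta>_mult \<beta>_carrier \<tau>_def)
  moreover have "\<beta> y p n \<in> K p z w"
    using n assms by (intro \<beta>_K_other) auto
  ultimately show ?thesis
    using I by (simp add: cmod_mem K_subgroup c_carrier \<beta>_carrier \<tau>_def)
qed

lemma shift_mem:
  assumes I: "{p, q, r, s, t} \<subseteq> I" and d: "distinct [p, q, r, s, t]"
    and c_trivial: "\<And>x y z. \<lbrakk>x \<in> I; y \<in> I; z \<in> I; {x, y, z} \<noteq> {p, q, r}\<rbrakk> \<Longrightarrow> c x y z = \<one>"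
  shows "c p q r \<in> H p q <#> H p r"
proof -
  have [simp]: "p \<in> I" "q \<in> I" "r \<in> I" "s \<in> I" "t \<in> I" using I by auto
  have [simp]: "p \<noteq> q" "p \<noteq> r" "p \<noteq> s" "p \<noteq> t" "q \<noteq> r" "q \<noteq> s" "q \<noteq> t" "r \<noteq> s" "r \<noteq> t" "s \<noteq> t"
    "q \<noteq> p" "r \<noteq> p" "s \<noteq> p" "t \<noteq> p" "r \<noteq> q" "s \<noteq> q" "t \<noteq> q" "s \<noteq> r" "t \<noteq> r" "t \<noteq> s"
    using d by auto
  \<comment> \<open>Among the shift values met below, all but \<open>c p q r\<close> end in
    \<open>s\<close> or \<open>t\<close>.\<close>
  have triv: "c x y z = \<one>" if "x \<in> I" "y \<in> I" "z \<in> {s, t}" for x y z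
  proof -
    have "z \<in> {x, y, z}" "z \<notin> {p, q, r}" using that d by auto
    then show ?thesis using that by (intro c_trivial) auto
  qed
  obtain u v where uv: "\<And>y. y \<in> I \<Longrightarrow> (u, v y) \<in> rel p y \<one>" "\<And>y. y \<in> I \<Longrightarrow> (v y, u) \<in> rel y p \<one>"
    using star_points[of p] by auto
  have "\<exists>h. h \<in> H p y \<and> (v y, v z) \<in> rel y z (\<beta> p y (inv (c p y z) \<otimes> h))"
    if "y \<in> I" "z \<in> I" "distinct [p, y, z]" for y z
    by (rule star_label[of p y z u "v y" "v z"]) (use uv that in auto)
  then obtain h where h: "\<And>y z. \<lbrakk>y \<in> I; z \<in> I; distinct [p, y, z]\<rbrakk> \<Longrightarrow> h y z \<in> H p y"
    and hv: "\<And>y z. \<lbrakk>y \<in> I; z \<in> I; distinct [p, y, z]\<rbrakk> \<Longrightarrow>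
      (v y, v z) \<in> rel y z (\<beta> p y (inv (c p y z) \<otimes> h y z))" by metis
  have hm [simp]: "h q r \<in> H p q" "h q s \<in> H p q" "h q t \<in> H p q" "h r s \<in> H p r" "h r t \<in> H p r"
    "h s t \<in> H p s" by (simp_all add: h)
  have tm [simp]: "\<tau> p q r (h r s) \<in> H p q" "\<tau> p q r (h r t) \<in> H p q" "\<tau> p q s (h s t) \<in> H p q"
    "\<tau> p r s (h s t) \<in> H p r" by (simp_all add: \<tau>_mem)
  have Hc: "g \<in> carrier G" if "g \<in> H p y" "y \<in> I" for g y
    using that H_subset[of p y] by auto
  have hc [simp]: "h q r \<in> carrier G" "h q s \<in> carrier G" "h q t \<in> carrier G" "h r s \<in> carrier G"
    "h r t \<in> carrier G" "h s t \<in> carrier G" "\<tau> p q r (h r s) \<in> carrier G"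
    "\<tau> p q r (h r t) \<in> carrier G" "\<tau> p q s (h s t) \<in> carrier G" "\<tau> p r s (h s t) \<in> carrier G"
    using hm[THEN Hc] tm[THEN Hc] by simp_all
  have H_mult: "a \<otimes> b \<in> H p y" if "a \<in> H p y" "b \<in> H p y" "y \<in> I" for a b y
    using that by (simp add: H_subgroup subgroup.m_closed)
  let ?f = "c p q r"
  have f: "?f \<in> carrier G" by (simp add: c_carrier)
  have tri: "cmod (K p z w) (inv (c p y w) \<otimes> h y w) (inv (c p y z) \<otimes> h y z \<otimes> \<tau> p y z (h z w))"
    if "{y, z, w} \<subseteq> I" "distinct [p, y, z, w]" "c p z w = \<one>" "c y z w = \<one>" for y z w
    using that by (intro star_triangle[of p y z w _ _ _ "v y" "v z" "v w"] h hv) auto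

  \<comment> \<open>No shift enters here. Both sides lie in \<open>H p q\<close>, which is
    independent of the modulus, so the congruence is an equation; the triangle \<open>rst\<close> is
    treated likewise inside \<open>H p r\<close>.\<close>
  have "cmod (K p s t) (h q t) (h q s \<otimes> \<tau> p q s (h s t))"
    using tri[of q s t] by (simp add: triv)
  then have qst: "h q t = h q s \<otimes> \<tau> p q s (h s t)"
    by (intro cmod_H_eq[of p q s t]) (simp_all add: H_mult)
  have "cmod (K p s t) (h r t) (h r s \<otimes> \<tau> p r s (h s t))"
    using tri[of r s t] by (simp add: triv)
  then have rst: "h r t = h r s \<otimes> \<tau> p r s (h s t)"
    by (intro cmod_H_eq[of p r s t]) (simp_all add: H_mult)
  obtain a b e where abe: "a \<in> H p q" "b \<in> H p r" "e \<in> H p s" "?f = a \<otimes> b \<otimes> e"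
    using span[of p q r s ?f] f by auto
  have [simp]: "a \<in> carrier G" "b \<in> carrier G" "e \<in> carrier G"
    using abe(1-3)[THEN Hc] by simp_all
  have K: "subgroup (K p r s) G" "subgroup (K p r t) G" by (simp_all add: K_subgroup)
  \<comment> \<open>Modulo \<open>K p r s\<close> the shift may be replaced by its component
    \<open>a\<close>. This places the right side of the triangle \<open>qrs\<close> in
    \<open>H p q\<close>, so that it too yields an equation.\<close>
  have fa: "cmod (K p r s) ?f a"
    using cmod_mem[OF K(1) set_multI[OF abe(2,3)], of a] abe(4) by (simp add: m_assoc)
  have "cmod (K p r s) (h q s) (inv ?f \<otimes> h q r \<otimes> \<tau> p q r (h r s))"
    using tri[of q r s] by (simp add: triv)
  moreover have "cmod (K p r s) (inv ?f \<otimes> h q r \<otimes> \<tau> p q r (h r s))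
      (inv a \<otimes> h q r \<otimes> \<tau> p q r (h r s))"
    by (intro cmod_mult cmod_inv fa K cmod_refl) simp_all
  ultimately have "cmod (K p r s) (h q s) (inv a \<otimes> h q r \<otimes> \<tau> p q r (h r s))"
    by (rule cmod_trans[OF K(1)])
  then have qrs: "h q s = inv a \<otimes> h q r \<otimes> \<tau> p q r (h r s)"
    by (intro cmod_H_eq[of p q r s]) (simp_all add: H_mult abe H_subgroup subgroup.m_inv_closed)
  \<comment> \<open>Inserting the three equations into the triangle \<open>qrt\<close> gives the
    common factor \<open>?X\<close> on both sides, next to the inverse of \<open>a\<close> on the
    left and of the shift on the right. Cancelling it compares \<open>a\<close> with the shift
    modulo \<open>K p r t\<close>, no longer modulo \<open>K p r s\<close>.\<close>
  let ?X = "h q r \<otimes> \<tau> p q r (h r s) \<otimes> \<tau> p q s (h s t)"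
  have "\<tau> p q r (h r t) = \<tau> p q r (h r s) \<otimes> \<tau> p q s (h s t)"
    unfolding rst by (simp add: \<tau>_mult \<tau>_comp)
  then have "cmod (K p r t) (?X \<otimes> inv a) (?X \<otimes> inv ?f)"
    using tri[of q r t] qst qrs f by (simp add: triv m_ac)
  then have "cmod (K p r t) (inv a) (inv ?f)"
    using f by (simp add: cmod_cancel K)
  from cmod_inv[OF K(2) this] have "cmod (K p r t) ?f a"
    using f cmod_sym[OF K(2)] by simp
  then have "cmod (K p r t) (a \<otimes> (b \<otimes> e)) (a \<otimes> \<one>)"
    by (simp add: abe(4) m_assoc)
  then have "cmod (K p r t) (b \<otimes> e) \<one>"
    using cmod_cancel[OF K(2), of "b \<otimes> e" \<one> a] by simp
  \<comment> \<open>The component \<open>b\<close> lies in the modulus and drops out, so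
    \<open>e\<close> alone is congruent to the unit; as \<open>H p s\<close> is independent of
    \<open>K p r t\<close>, it equals the unit.\<close>
  moreover have "cmod (K p r t) (b \<otimes> e) e"
    using abe H_le_K[of p r t] cmod_mem[OF K(2), of b e] by (auto simp: m_comm)
  ultimately have "cmod (K p r t) e \<one>"
    using cmod_trans[OF K(2)] cmod_sym[OF K(2)] by blast
  then have "e = \<one>"
    using abe by (intro cmod_H_eq[of p s r t]) (simp_all add: H_subgroup subgroup.one_closed)
  then show ?thesis
    using abe by (simp add: set_multI)
qed

end

section \<open>The four subgroups of the cube\<close>

lemma comm_group_cube:
  fixes F :: "('a, 'b) monoid_scheme"
  assumes "comm_group F"
  shows "comm_group (cube F)"
proof -
  interpret F: comm_group F by fact
  have "group (cube F)"
    by (intro DirProd_group F.is_group)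
  then show ?thesis
    by (rule group.group_comm_groupI) (auto simp: F.m_comm)
qed

context
  fixes F :: "('a, 'b) monoid_scheme"
  assumes F: "comm_group F"
begin

interpretation F: comm_group F by (fact F)
interpretation cube: comm_group "cube F" by (rule comm_group_cube) (fact F)

lemma inv_cube:
  "\<lbrakk>a \<in> carrier F; b \<in> carrier F; d \<in> carrier F\<rbrakk> \<Longrightarrow>
    inv\<^bsub>cube F\<^esub> (a, b, d) = (inv\<^bsub>F\<^esub> a, inv\<^bsub>F\<^esub> b, inv\<^bsub>F\<^esub> d)"
  by (simp add: inv_DirProd DirProd_group F.is_group)

lemma L_subgroup: "subgroup (L F m) (cube F)"
  by (rule cube.subgroupI) (auto simp: L_def inv_cube split: if_splits)

text \<open>Comparison of coordinates settles every choice of indices: any diagonal element involved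
  shows up in a coordinate that has to be the unit, and the axis elements have separate
  coordinates.\<close>

lemma L_indep:
  assumes "distinct [i, j, k]" "i < 4" "j < 4" "k < 4"
    and "h \<in> L F i" "h \<in> L F j <#>\<^bsub>cube F\<^esub> L F k"
  shows "h = \<one>\<^bsub>cube F\<^esub>"
proof -
  obtain b d where bd: "b \<in> L F j" "d \<in> L F k" "h = b \<otimes>\<^bsub>cube F\<^esub> d"
    using assms(6) by (auto simp: set_mult_def)
  have "i = 0 \<or> i = 1 \<or> i = 2 \<or> i = 3" "j = 0 \<or> j = 1 \<or> j = 2 \<or> j = 3"
    "k = 0 \<or> k = 1 \<or> k = 2 \<or> k = 3" "i \<noteq> j" "i \<noteq> k" "j \<noteq> k"
    using assms(1-4) by auto
  then show ?thesis
    using bd(1,2) assms(5) unfolding bd(3)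
    by (elim disjE) (auto simp: L_def)
qed

text \<open>If the diagonal takes part, the coordinate of the missing axis comes from the diagonal
  factor alone and thus determines it; the two axis factors then correct the other coordinates. The
  order on the indices leaves only four cases.\<close>

lemma L_span_sorted:
  assumes "i < j" "j < k" "k < 4" "g \<in> carrier (cube F)"
  shows "\<exists>a\<in>L F i. \<exists>b\<in>L F j. \<exists>d\<in>L F k. g = a \<otimes>\<^bsub>cube F\<^esub> b \<otimes>\<^bsub>cube F\<^esub> d"
proof -
  obtain u v w where g: "g = (u, v, w)" and [simp]: "u \<in> carrier F" "v \<in> carrier F" "w \<in> carrier F"
    using assms(4) by auto
  consider "i = 0 \<and> j = 1 \<and> k = 2" | "i = 0 \<and> j = 1 \<and> k = 3" | "i = 0 \<and> j = 2 \<and> k = 3"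
    | "i = 1 \<and> j = 2 \<and> k = 3"
    using assms(1-3) by linarith
  then show ?thesis
  proof cases
    case 1
    then show ?thesis unfolding g
      by (intro bexI[of _ "(u, \<one>\<^bsub>F\<^esub>, \<one>\<^bsub>F\<^esub>)"] bexI[of _ "(\<one>\<^bsub>F\<^esub>, v, \<one>\<^bsub>F\<^esub>)"] bexI[of _ "(\<one>\<^bsub>F\<^esub>, \<one>\<^bsub>F\<^esub>, w)"])
        (auto simp: L_def)
  next
    case 2
    then show ?thesis unfolding g
      by (intro bexI[of _ "(u \<otimes>\<^bsub>F\<^esub> inv\<^bsub>F\<^esub> w, \<one>\<^bsub>F\<^esub>, \<one>\<^bsub>F\<^esub>)"]
          bexI[of _ "(\<one>\<^bsub>F\<^esub>, v \<otimes>\<^bsub>F\<^esub> inv\<^bsub>F\<^esub> w, \<one>\<^bsub>F\<^esub>)"] bexI[of _ "(w, w, w)"])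
        (auto simp: L_def F.m_assoc)
  next
    case 3
    then show ?thesis unfolding g
      by (intro bexI[of _ "(u \<otimes>\<^bsub>F\<^esub> inv\<^bsub>F\<^esub> v, \<one>\<^bsub>F\<^esub>, \<one>\<^bsub>F\<^esub>)"]
          bexI[of _ "(\<one>\<^bsub>F\<^esub>, \<one>\<^bsub>F\<^esub>, w \<otimes>\<^bsub>F\<^esub> inv\<^bsub>F\<^esub> v)"] bexI[of _ "(v, v, v)"])
        (auto simp: L_def F.m_assoc)
  next
    case 4
    then show ?thesis unfolding g
      by (intro bexI[of _ "(\<one>\<^bsub>F\<^esub>, v \<otimes>\<^bsub>F\<^esub> inv\<^bsub>F\<^esub> u, \<one>\<^bsub>F\<^esub>)"]
          bexI[of _ "(\<one>\<^bsub>F\<^esub>, \<one>\<^bsub>F\<^esub>, w \<otimes>\<^bsub>F\<^esub> inv\<^bsub>F\<^esub> u)"] bexI[of _ "(u, u, u)"])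
        (auto simp: L_def F.m_assoc)
  qed
qed

lemma L_span:
  assumes "distinct [i, j, k]" "i < 4" "j < 4" "k < 4" "g \<in> carrier (cube F)"
  shows "\<exists>a\<in>L F i. \<exists>b\<in>L F j. \<exists>d\<in>L F k. g = a \<otimes>\<^bsub>cube F\<^esub> b \<otimes>\<^bsub>cube F\<^esub> d"
proof -
  let ?S = "\<lambda>i j k. \<exists>a\<in>L F i. \<exists>b\<in>L F j. \<exists>d\<in>L F k. g = a \<otimes>\<^bsub>cube F\<^esub> b \<otimes>\<^bsub>cube F\<^esub> d"
  have c: "a \<in> carrier (cube F)" if "a \<in> L F i" for a i
    using that L_subgroup by (rule subgroup.mem_carrier[rotated])
  have s1: "?S j i k" if "?S i j k" for i j k
    using that c cube.m_comm by metis
  \<comment> \<open>Together with \<open>s1\<close> this allows exchanging neighbouring factors,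
    which generates all orders of the three subgroups.\<close>
  have s2: "?S i k j" if "?S i j k" for i j k
    using that c cube.m_assoc cube.m_comm by metis
  have sorted: "?S i j k" if "i < j" "j < k" "k < 4" for i j k
    using that assms(5) by (rule L_span_sorted)
  consider "i < j \<and> j < k" | "i < k \<and> k < j" | "j < i \<and> i < k" | "j < k \<and> k < i"
    | "k < i \<and> i < j" | "k < j \<and> j < i"
    using assms(1) by fastforce
  then show ?thesis
  proof cases
    case 1 then show ?thesis using sorted[of i j k] assms by blast
  next
    case 2 show ?thesis by (intro s2[of i k j] sorted) (use 2 assms in auto)
  next
    case 3 show ?thesis by (intro s1[of j i k] sorted) (use 3 assms in auto)
  next
    case 4 show ?thesis by (intro s1[of j i k] s2[of j k i] sorted) (use 4 assms in auto)
  next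
    case 5 show ?thesis by (intro s2[of i k j] s1[of k i j] sorted) (use 5 assms in auto)
  next
    case 6 show ?thesis by (intro s1[of j i k] s2[of j k i] s1[of k j i] sorted) (use 6 assms in auto)
  qed
qed

text \<open>If two of the subgroups were equal, independence together with a third one would make
  them trivial, whereas each contains an image of every element of \<open>F\<close>.\<close>

lemma L_inj:
  assumes "carrier F \<noteq> {\<one>\<^bsub>F\<^esub>}"
  shows "inj_on (L F) {..<4}"
proof (rule inj_onI, rule ccontr)
  fix m n :: nat assume mn: "m \<in> {..<4}" "n \<in> {..<4}" "L F m = L F n" "m \<noteq> n"
  obtain a where a: "a \<in> carrier F" "a \<noteq> \<one>\<^bsub>F\<^esub>" using assms F.one_closed by blast
  obtain k :: nat where k: "k < 4" "distinct [m, n, k]"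
  proof -
    have "card {m, n} < card {..<4::nat}" by (simp add: card_insert_if)
    then have "\<exists>k. k \<in> {..<4} - {m, n}"
      by (metis card_mono finite.emptyI finite_insert linorder_not_less subsetI DiffI)
    then show thesis using that mn(4) by auto
  qed
  have "h = \<one>\<^bsub>cube F\<^esub>" if "h \<in> L F m" for h
  proof (rule L_indep[of m n k])
    show "h \<in> L F n <#>\<^bsub>cube F\<^esub> L F k"
      using that mn(3) cube.subgroup_set_mult_upper(1)[OF L_subgroup L_subgroup] by blast
  qed (use that mn k in auto)
  moreover obtain h where "h \<in> L F m" "h \<noteq> \<one>\<^bsub>cube F\<^esub>"
    using a by (cases "m = 0"; cases "m = 1"; cases "m = 2") (auto simp: L_def)
  ultimately show False by blast
qed

end

section \<open>The shifted group coset system\<close>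

locale group_system =
  fixes F :: "('a, 'b) monoid_scheme" and I :: "'i set" and H :: "'i \<Rightarrow> 'i \<Rightarrow> 'a triple set"
    and \<alpha> :: "('a triple set \<Rightarrow> 'a triple set) \<Rightarrow> 'a triple \<Rightarrow> 'a triple"
  assumes comm: "comm_group F" and nontrivial: "carrier F \<noteq> {\<one>\<^bsub>F\<^esub>}"
    and card_I: "card I = 5"
    and choice: "subgroup_choice F I H"
    and automorphisms: "automorphism_system F \<alpha>"
begin

section \<open>The subgroups at one index and the permutations between indices\<close>

lemma H_self: "x \<in> I \<Longrightarrow> H x x = {\<one>\<^bsub>cube F\<^esub>}"
  using choice unfolding subgroup_choice_def by blast

lemma H_image:
  assumes "x \<in> I"
  shows "H x ` (I - {x}) = Ls F"
proof -
  have "{H x y | y. y \<in> I \<and> y \<noteq> x} = Ls F"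
    using choice assms unfolding subgroup_choice_def by blast
  then show ?thesis by blast
qed

lemma H_in_Ls: "\<lbrakk>x \<in> I; y \<in> I; x \<noteq> y\<rbrakk> \<Longrightarrow> H x y \<in> Ls F"
  using H_image by blast

text \<open>Four indices are mapped onto four subgroups; that these are four is where non-triviality
  of \<open>F\<close> enters.\<close>

lemma H_inj:
  assumes "x \<in> I"
  shows "inj_on (H x) (I - {x})"
proof (rule eq_card_imp_inj_on)
  show "finite (I - {x})" using card_I by (metis card.infinite finite_Diff numeral_eq_Suc Zero_not_Suc)
  show "card (H x ` (I - {x})) = card (I - {x})"
    using assms card_I by (simp add: H_image card_image L_inj[OF comm nontrivial])
qed

lemma H_eq_iff:
  "\<lbrakk>x \<in> I; y \<in> I; z \<in> I; x \<noteq> y; x \<noteq> z\<rbrakk> \<Longrightarrow> H x y = H x z \<longleftrightarrow> y = z"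
  using inj_on_eq_iff[OF H_inj] by simp

text \<open>Justifies the definite description. The permutation exists as the inverse of
  \<open>H x\<close>, followed by the exchange of \<open>x\<close> and \<open>y\<close>, followed by
  \<open>H y\<close>; it is unique because the members of \<open>Ls F\<close> are exactly the
  \<open>H x u\<close> with \<open>u\<close> different from \<open>x\<close>.\<close>

lemma perm_spec:
  assumes "x \<in> I" "y \<in> I" "x \<noteq> y"
  shows "perm F I H x y permutes Ls F"
    and "perm F I H x y (H x y) = H y x"
    and "\<And>u. \<lbrakk>u \<in> I; u \<noteq> x; u \<noteq> y\<rbrakk> \<Longrightarrow> perm F I H x y (H x u) = H y u"
proof -
  let ?P = "\<lambda>\<pi>. \<pi> permutes Ls F \<and> \<pi> (H x y) = H y x \<and> (\<forall>u\<in>I - {x, y}. \<pi> (H x u) = H y u)"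
  let ?g = "H y \<circ> Transposition.transpose x y \<circ> inv_into (I - {x}) (H x)"
  let ?\<pi> = "\<lambda>S. if S \<in> Ls F then ?g S else S"
  have bx: "bij_betw (H x) (I - {x}) (Ls F)" and b: "bij_betw (H y) (I - {y}) (Ls F)"
    using assms by (simp_all add: bij_betw_def H_inj H_image)
  have t: "bij_betw (Transposition.transpose x y) (I - {x}) (I - {y})"
    using assms
    by (intro bij_betw_byWitness[where f' = "Transposition.transpose x y"])
      (auto simp: Transposition.transpose_def)
  have "bij_betw ?g (Ls F) (Ls F)"
    by (intro bij_betw_trans[OF bij_betw_trans[OF bij_betw_inv_into[OF bx] t] b, unfolded comp_assoc[symmetric]])
  then have "bij_betw ?\<pi> (Ls F) (Ls F)"
    by (rule bij_betw_cong[THEN iffD1, rotated]) simp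
  then have perm: "?\<pi> permutes Ls F"
    by (rule bij_imp_permutes) simp
  have val: "?\<pi> (H x u) = H y (Transposition.transpose x y u)" if "u \<in> I" "u \<noteq> x" for u
    using that assms H_in_Ls[of x u] by (simp add: inv_into_f_f[OF H_inj])
  have "?P ?\<pi>"
  proof (intro conjI ballI perm)
    show "?\<pi> (H x y) = H y x" using val[of y] assms by simp
    show "?\<pi> (H x u) = H y u" if "u \<in> I - {x, y}" for u
      using val[of u] that by (simp add: transpose_eq_iff)
  qed
  moreover have "\<pi> = \<sigma>" if "?P \<pi>" "?P \<sigma>" for \<pi> \<sigma>
  proof
    fix S
    show "\<pi> S = \<sigma> S"
    proof (cases "S \<in> Ls F")
      case True
      then obtain u where "u \<in> I" "u \<noteq> x" "S = H x u" using H_image[OF assms(1)] by blast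
      then show ?thesis using that by (cases "u = y") auto
    next
      case False
      then show ?thesis using that permutes_not_in by metis
    qed
  qed
  ultimately have "\<exists>!\<pi>. ?P \<pi>" by blast
  from theI'[OF this] have "?P (perm F I H x y)" unfolding perm_def .
  then show "perm F I H x y permutes Ls F" "perm F I H x y (H x y) = H y x"
    "\<And>u. \<lbrakk>u \<in> I; u \<noteq> x; u \<noteq> y\<rbrakk> \<Longrightarrow> perm F I H x y (H x u) = H y u" by blast+
qed

lemma perm_comp_inverse:
  assumes "x \<in> I" "y \<in> I" "x \<noteq> y"
  shows "perm F I H y x \<circ> perm F I H x y = id"
proof
  fix S
  show "(perm F I H y x \<circ> perm F I H x y) S = id S"
  proof (cases "S \<in> Ls F")
    case True
    then obtain u where "u \<in> I" "u \<noteq> x" "S = H x u" using H_image[OF assms(1)] by blast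
    then show ?thesis using assms perm_spec by (cases "u = y") auto
  next
    case False
    then show ?thesis using assms by (simp add: permutes_not_in[OF perm_spec(1)])
  qed
qed

text \<open>The routes from \<open>x\<close> to \<open>z\<close> differ only on \<open>H x y\<close>
  and \<open>H x z\<close>: through \<open>y\<close> these end at \<open>H z x\<close> and
  \<open>H z y\<close>, directly at \<open>H z y\<close> and \<open>H z x\<close>.\<close>

lemma perm_comp:
  assumes "x \<in> I" "y \<in> I" "z \<in> I" "distinct [x, y, z]"
  shows "perm F I H y z \<circ> perm F I H x y =
    Transposition.transpose (H z x) (H z y) \<circ> perm F I H x z"
proof
  fix S
  show "(perm F I H y z \<circ> perm F I H x y) S =
    (Transposition.transpose (H z x) (H z y) \<circ> perm F I H x z) S"
  proof (cases "S \<in> Ls F")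
    case True
    then obtain u where u: "u \<in> I" "u \<noteq> x" "S = H x u" using H_image[OF assms(1)] by blast
    consider "u = y" | "u = z" | "u \<noteq> y" "u \<noteq> z" by blast
    then show ?thesis
    proof cases
      case 1 then show ?thesis using assms u by (simp add: perm_spec(2,3))
    next
      case 2 then show ?thesis
        using assms u perm_spec(3)[of x y z] perm_spec(2)[of y z] perm_spec(2)[of x z] by auto
    next
      case 3
      then have "H z u \<noteq> H z x" "H z u \<noteq> H z y" using assms u by (auto simp: H_eq_iff)
      then show ?thesis
        using assms u 3 perm_spec(3)[of x y u] perm_spec(3)[of y z u] perm_spec(3)[of x z u]
        by (auto simp: transpose_apply_other)
    qed
  next
    case False
    moreover from this have "S \<noteq> H z x" "S \<noteq> H z y" using assms H_in_Ls by auto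
    ultimately show ?thesis
      using assms by (auto simp: permutes_not_in[OF perm_spec(1)] transpose_apply_other)
  qed
qed

section \<open>Laws of the automorphism system\<close>

lemma \<alpha>_iso: "\<pi> permutes Ls F \<Longrightarrow> \<alpha> \<pi> \<in> iso (cube F) (cube F)"
proof -
  have "\<forall>\<pi>. \<pi> permutes Ls F \<longrightarrow> \<alpha> \<pi> \<in> iso (cube F) (cube F)"
    using automorphisms unfolding automorphism_system_def by (elim conjE)
  then show "\<pi> permutes Ls F \<Longrightarrow> \<alpha> \<pi> \<in> iso (cube F) (cube F)" by blast
qed

lemma \<alpha>_image:
  assumes "\<pi> permutes Ls F" "S \<in> Ls F"
  shows "\<alpha> \<pi> ` S = \<pi> S"
proof -
  have "\<forall>\<pi>. \<pi> permutes Ls F \<longrightarrow> (\<forall>m<4. \<alpha> \<pi> ` L F m = \<pi> (L F m))"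
    using automorphisms unfolding automorphism_system_def by (elim conjE)
  then show ?thesis using assms by blast
qed

lemma \<alpha>_id:
  assumes "g \<in> carrier (cube F)"
  shows "\<alpha> id g = g"
proof -
  have "\<forall>g\<in>carrier (cube F). \<alpha> id g = g"
    using automorphisms unfolding automorphism_system_def by (elim conjE)
  then show ?thesis using assms by (rule bspec)
qed

lemma \<alpha>_comp:
  assumes "\<pi> permutes Ls F" "\<sigma> permutes Ls F" "g \<in> carrier (cube F)"
  shows "\<alpha> \<sigma> (\<alpha> \<pi> g) = \<alpha> (\<sigma> \<circ> \<pi>) g"
proof -
  have "\<forall>\<pi> \<sigma>. \<pi> permutes Ls F \<longrightarrow> \<sigma> permutes Ls F \<longrightarrow>
      (\<forall>g\<in>carrier (cube F). \<alpha> \<sigma> (\<alpha> \<pi> g) = \<alpha> (\<sigma> \<circ> \<pi>) g)"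
    using automorphisms unfolding automorphism_system_def by (elim conjE)
  with assms show ?thesis by blast
qed

lemma \<alpha>_transpose:
  assumes "{S, T, R} \<subseteq> Ls F" "distinct [S, T, R]" "g \<in> R"
  shows "\<alpha> (Transposition.transpose S T) g = g"
proof -
  have *: "\<forall>m<4. \<forall>n<4. \<forall>k<4. distinct [m, n, k] \<longrightarrow>
      (\<forall>g\<in>L F k. \<alpha> (Transposition.transpose (L F m) (L F n)) g = g)"
    using automorphisms unfolding automorphism_system_def by (elim conjE)
  obtain m n k where mnk: "m < 4" "n < 4" "k < 4" "S = L F m" "T = L F n" "R = L F k"
    using assms(1) by auto
  then have "distinct [m, n, k]" using assms(2) by auto
  then show ?thesis
    using * mnk assms(3) by blast
qed

section \<open>The frame formed by the transports\<close>

definition transport :: "'i \<Rightarrow> 'i \<Rightarrow> 'a triple \<Rightarrow> 'a triple" where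
  "transport x y = (if x = y then id else alpha_map F I H \<alpha> x y)"

lemma transport_image:
  assumes "x \<in> I" "y \<in> I" "x \<noteq> y" "z \<in> I" "z \<noteq> x" "h \<in> H x z"
  shows "transport x y h \<in> perm F I H x y (H x z)"
  using assms \<alpha>_image[OF perm_spec(1)[of x y] H_in_Ls[of x z]]
  unfolding transport_def alpha_map_def by auto

sublocale cube: comm_group "cube F"
  by (rule comm_group_cube) (rule comm)

lemma transport_hom:
  assumes "x \<in> I" "y \<in> I"
  shows "transport x y \<in> hom (cube F) (cube F)"
proof (cases "x = y")
  case True
  then show ?thesis unfolding transport_def by (simp add: hom_def)
next
  case False
  then show ?thesis
    using assms \<alpha>_iso[OF perm_spec(1)[of x y]]
    unfolding transport_def alpha_map_def iso_def by simp
qed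

lemma transport_inverse:
  assumes "x \<in> I" "y \<in> I" "g \<in> carrier (cube F)"
  shows "transport y x (transport x y g) = g"
proof (cases "x = y")
  case False
  then show ?thesis
    using assms \<alpha>_comp[OF perm_spec(1)[of x y] perm_spec(1)[of y x]] perm_comp_inverse[of x y] \<alpha>_id
    unfolding transport_def alpha_map_def by simp
qed (simp add: transport_def)

lemma subgroup_H_cube:
  assumes "x \<in> I" "y \<in> I"
  shows "subgroup (H x y) (cube F)"
proof (cases "x = y")
  case True
  then show ?thesis using assms H_self cube.triv_subgroup by simp
next
  case False
  then show ?thesis using assms H_in_Ls[of x y] L_subgroup[OF comm] by auto
qed

sublocale coset_frame "cube F" I H transport
proof (intro coset_frame.intro coset_frame_axioms.intro)
  show "comm_group (cube F)" by (rule comm_group_cube) (rule comm)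
next
  fix x y assume xy: "x \<in> I" "y \<in> I"
  show "subgroup (H x y) (cube F)" using xy by (rule subgroup_H_cube)
  show "transport x y \<in> hom (cube F) (cube F)" using xy by (rule transport_hom)
  show "transport y x (transport x y g) = g" if "g \<in> carrier (cube F)" for g
    using xy that by (rule transport_inverse)
  show "transport x y h \<in> H y x" if "h \<in> H x y" for h
    using xy that transport_image[of x y y h] perm_spec(2)[of x y]
    by (cases "x = y") (auto simp: transport_def)
  show "transport x y h \<in> H y z" if "z \<in> I" "distinct [x, y, z]" "h \<in> H x z" for z h
    using xy that transport_image[of x y z h] perm_spec(3)[of x y z] by auto
next
  fix x y z w h assume a: "{x, y, z, w} \<subseteq> I" "distinct [x, y, z, w]" "h \<in> H x w"
  then have p: "perm F I H x y permutes Ls F" "perm F I H y z permutes Ls F" "perm F I H x z permutes Ls F"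
    by (auto intro: perm_spec(1))
  have t: "Transposition.transpose (H z x) (H z y) permutes Ls F"
    using a by (intro permutes_swap_id H_in_Ls) auto
  have h: "h \<in> carrier (cube F)"
    using a subgroup.mem_carrier[OF subgroup_H_cube[of x w]] by simp
  have zw: "\<alpha> (perm F I H x z) h \<in> H z w"
    using transport_image[of x z w h] perm_spec(3)[of x z w] a by (auto simp: transport_def alpha_map_def)
  \<comment> \<open>The two routes differ by the automorphism of a transposition, which is the
    identity on the third subgroup \<open>H z w\<close>, where the direct image of \<open>h\<close>
    lies.\<close>
  have "\<alpha> (perm F I H y z) (\<alpha> (perm F I H x y) h) =
      \<alpha> (Transposition.transpose (H z x) (H z y)) (\<alpha> (perm F I H x z) h)"
    using \<alpha>_comp[OF p(1,2) h] \<alpha>_comp[OF p(3) t h] perm_comp[of x y z] a by simp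
  also have "\<dots> = \<alpha> (perm F I H x z) h"
    using a H_in_Ls[of z] by (intro \<alpha>_transpose[OF _ _ zw]) (auto simp: H_eq_iff)
  finally show "transport y z (transport x y h) = transport x z h"
    using a by (simp add: transport_def alpha_map_def)
next
  fix x y z w assume a: "{x, y, z, w} \<subseteq> I" "distinct [x, y, z, w]"
  then obtain i j k where ijk: "H x y = L F i" "H x z = L F j" "H x w = L F k" "i < 4" "j < 4" "k < 4"
    using H_in_Ls[of x y] H_in_Ls[of x z] H_in_Ls[of x w] by auto
  moreover have "distinct [H x y, H x z, H x w]" using a by (auto simp: H_eq_iff)
  ultimately have d: "distinct [i, j, k]" by auto
  show "\<exists>a\<in>H x y. \<exists>b\<in>H x z. \<exists>d\<in>H x w. g = a \<otimes>\<^bsub>cube F\<^esub> b \<otimes>\<^bsub>cube F\<^esub> d"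
    if "g \<in> carrier (cube F)" for g
    unfolding ijk by (rule L_span[OF comm d ijk(4-6) that])
  show "h = \<one>\<^bsub>cube F\<^esub>" if "h \<in> H x y" "h \<in> H x z <#>\<^bsub>cube F\<^esub> H x w" for h
    using L_indep[OF comm d ijk(4-6)] that unfolding ijk by blast
next
  fix x y z assume "x \<in> I" "y \<in> I" "z \<in> I"
  have "card {x, y, z} < card I"
    unfolding card_I by (simp add: card_insert_if)
  then have "\<not> I \<subseteq> {x, y, z}" using card_mono[of "{x, y, z}" I] by auto
  then show "\<exists>w\<in>I. w \<notin> {x, y, z}" by blast
qed (auto simp: H_self transport_def simp del: one_DirProd)

lemma phi_coset:
  assumes "x \<in> I" "y \<in> I" "z \<in> I" "a \<in> carrier (cube F)"
  shows "phi F I H \<alpha> x y (a <#\<^bsub>cube F\<^esub> (H x y <#>\<^bsub>cube F\<^esub> H x z)) =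
    transport x y a <#\<^bsub>cube F\<^esub> (H y x <#>\<^bsub>cube F\<^esub> H y z)"
proof (cases "x = y")
  case True
  then show ?thesis by (simp add: phi_def transport_def)
next
  case False
  then show ?thesis
    using union_\<beta>_cosets[OF assms] by (simp only: phi_def transport_def if_False)
qed

section \<open>The shift through representatives\<close>

definition shift_rep :: "'a triple \<Rightarrow> 'i \<Rightarrow> 'i \<Rightarrow> 'i \<Rightarrow> 'i \<Rightarrow> 'i \<Rightarrow> 'i \<Rightarrow> 'a triple" where
  "shift_rep f p q r x y z =
     (if (x, y, z) \<in> {(p, q, r), (q, r, p), (r, p, q)} then transport p x f
      else if (x, y, z) \<in> {(p, r, q), (q, p, r), (r, q, p)} then inv\<^bsub>cube F\<^esub> (transport p x f)
      else \<one>\<^bsub>cube F\<^esub>)"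

text \<open>Rotation is the law with content: a cyclic shift of the indices preserves the sign, so
  it remains to compare the transport of the element at \<open>x\<close> with the element at
  \<open>y\<close>.\<close>

lemma shifted_frame_shift:
  assumes pqr: "{p, q, r} \<subseteq> I" "distinct [p, q, r]" and f: "f \<in> carrier (cube F)"
  shows "shifted_frame (cube F) I H transport (phi F I H \<alpha>) (shift F I H \<alpha> f p q r) (shift_rep f p q r)"
proof (intro shifted_frame.intro shifted_frame_axioms.intro coset_frame_axioms)
  fix x y z assume I: "x \<in> I" "y \<in> I" "z \<in> I"
  have fx: "transport p w f \<in> carrier (cube F)" if "w \<in> I" for w
    using pqr f that by (intro \<beta>_carrier) auto
  show "phi F I H \<alpha> x y (a <#\<^bsub>cube F\<^esub> (H x y <#>\<^bsub>cube F\<^esub> H x z)) =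
    transport x y a <#\<^bsub>cube F\<^esub> (H y x <#>\<^bsub>cube F\<^esub> H y z)" if "a \<in> carrier (cube F)" for a
    using I that by (rule phi_coset)
  have "shift_elem F I H \<alpha> f p x = transport p x f"
    by (simp add: shift_elem_def transport_def)
  then show "shift F I H \<alpha> f p q r x y z = shift_rep f p q r x y z <#\<^bsub>cube F\<^esub> (H x y <#>\<^bsub>cube F\<^esub> H x z)"
    using cube.lcos_mult_one[OF subgroup.subset[OF K_subgroup[OF I]]]
    by (simp add: shift_def shift_rep_def Let_def)
  show "shift_rep f p q r x y z \<in> carrier (cube F)"
    unfolding shift_rep_def using fx[OF I(1)] cube.inv_closed cube.one_closed by (simp del: carrier_DirProd)
  let ?pos = "{(p, q, r), (q, r, p), (r, p, q)}" and ?neg = "{(p, r, q), (q, p, r), (r, q, p)}"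
  show "shift_rep f p q r x y z = \<one>\<^bsub>cube F\<^esub>" if "\<not> distinct [x, y, z]"
  proof -
    have "(x, y, z) \<notin> ?pos" "(x, y, z) \<notin> ?neg" using that pqr(2) by auto
    then show ?thesis unfolding shift_rep_def by (simp only: if_False)
  qed
  show "shift_rep f p q r x z y = inv\<^bsub>cube F\<^esub> shift_rep f p q r x y z"
  proof -
    have sw: "(x, z, y) \<in> ?pos \<longleftrightarrow> (x, y, z) \<in> ?neg" "(x, z, y) \<in> ?neg \<longleftrightarrow> (x, y, z) \<in> ?pos"
      by auto
    have "\<not> ((x, y, z) \<in> ?pos \<and> (x, y, z) \<in> ?neg)" using pqr(2) by auto
    then show ?thesis
      unfolding shift_rep_def sw
      by (cases "(x, y, z) \<in> ?pos"; cases "(x, y, z) \<in> ?neg")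
        (simp_all only: if_True if_False cube.inv_inv[OF fx[OF I(1)]] cube.inv_one simp_thms)
  qed
  \<comment> \<open>If \<open>p\<close> is \<open>x\<close> or \<open>y\<close>, the two elements
    are equal; if \<open>p\<close> is \<open>z\<close>, they are the two routes of
    \<open>\<beta>_triangle\<close> and agree modulo \<open>K y x z\<close>.\<close>
  have rotate: "cube.cmod (K y x z) (transport x y (transport p x f)) (transport p y f)"
    if "p \<in> {x, y, z}"
  proof (cases "p = z")
    case True
    then show ?thesis using \<beta>_triangle[of y x p f] I f by blast
  next
    case False
    have "transport p p f = f" by (simp add: transport_def)
    then have "transport x y (transport p x f) = transport p y f"
      using that False transport_inverse[of p x f] I f by (elim insertE) (simp_all del: carrier_DirProd)
    then show ?thesis
      using cube.cmod_refl[OF K_subgroup[of y x z] fx[OF I(2)]] I by (simp only:)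
  qed
  have K: "subgroup (K y x z) (cube F)" using I by (intro K_subgroup)
  consider "(x, y, z) \<in> ?pos" | "(x, y, z) \<notin> ?pos" "(x, y, z) \<in> ?neg"
    | "(x, y, z) \<notin> ?pos" "(x, y, z) \<notin> ?neg" by blast
  then show "cube.cmod (K y x z) (transport x y (shift_rep f p q r x y z)) (shift_rep f p q r y z x)"
  proof cases
    case 1
    then have "(y, z, x) \<in> ?pos" "p \<in> {x, y, z}" by auto
    then show ?thesis using 1 rotate unfolding shift_rep_def by (simp only: if_True)
  next
    case 2
    then have "(y, z, x) \<notin> ?pos" "(y, z, x) \<in> ?neg" "p \<in> {x, y, z}" by auto
    then show ?thesis
      using 2 cube.cmod_inv[OF K rotate] \<beta>_inv[OF I(1,2) fx[OF I(1)]]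
      unfolding shift_rep_def by (simp only: if_True if_False)
  next
    case 3
    then have "(y, z, x) \<notin> ?pos" "(y, z, x) \<notin> ?neg" by auto
    then show ?thesis
      using 3 cube.cmod_refl[OF K cube.one_closed] \<beta>_one[OF I(1,2)]
      unfolding shift_rep_def by (simp only: if_False)
  qed
qed

lemma polygroupoid_shifted_structure:
  assumes "{p, q, r} \<subseteq> I" "distinct [p, q, r]" "f \<in> carrier (cube F)"
  shows "polygroupoid (shifted_structure F I H \<alpha> f p q r)"
  unfolding shifted_structure_def
  by (rule shifted_frame.polygroupoid_M[OF shifted_frame_shift[OF assms]])

lemma representation_shifted_structure:
  assumes I: "{p, q, r, s, t} \<subseteq> I" and d: "distinct [p, q, r, s, t]" and f: "f \<in> carrier (cube F)"
    and rep: "representation (shifted_structure F I H \<alpha> f p q r) U rep"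
  shows "f \<in> H p q <#>\<^bsub>cube F\<^esub> H p r"
proof -
  have "shifted_frame (cube F) I H transport (phi F I H \<alpha>) (shift F I H \<alpha> f p q r) (shift_rep f p q r)"
    using I d f by (intro shifted_frame_shift) auto
  then have rf: "represented_frame (cube F) I H transport (phi F I H \<alpha>) (shift F I H \<alpha> f p q r)
      (shift_rep f p q r) U rep"
    using rep unfolding shifted_structure_def
    by (intro represented_frame.intro represented_frame_axioms.intro)
  have triv: "shift_rep f p q r x y z = \<one>\<^bsub>cube F\<^esub>" if "{x, y, z} \<noteq> {p, q, r}" for x y z
  proof -
    have "(x, y, z) \<notin> {(p, q, r), (q, r, p), (r, p, q)}" "(x, y, z) \<notin> {(p, r, q), (q, p, r), (r, q, p)}"
      using that by auto
    then show ?thesis unfolding shift_rep_def by (simp only: if_False)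
  qed
  have "shift_rep f p q r p q r \<in> H p q <#>\<^bsub>cube F\<^esub> H p r"
    by (rule represented_frame.shift_mem[OF rf I d triv])
  then show ?thesis by (simp add: shift_rep_def transport_def)
qed

end

theorem theorem4p2:
  fixes F :: "('a, 'b) monoid_scheme"
    and I :: "'i set" and p q r s t :: 'i
    and H :: "'i \<Rightarrow> 'i \<Rightarrow> 'a triple set"
    and \<alpha> :: "('a triple set \<Rightarrow> 'a triple set) \<Rightarrow> 'a triple \<Rightarrow> 'a triple"
    and f :: "'a triple"
  assumes "comm_group F" and "carrier F \<noteq> {\<one>\<^bsub>F\<^esub>}"
    and "I = {p, q, r, s, t}" and "distinct [p, q, r, s, t]"
    and "subgroup_choice F I H"
    and "automorphism_system F \<alpha>"
    and "f \<in> carrier (cube F)" and "f \<notin> H p q <#>\<^bsub>cube F\<^esub> H p r"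
  shows "polygroupoid (shifted_structure F I H \<alpha> f p q r) \<and>
    \<not> representable TYPE('u) (shifted_structure F I H \<alpha> f p q r)"
proof -
  have "card I = 5" using assms(3,4) by simp
  then interpret group_system F I H \<alpha>
    using assms by (intro group_system.intro)
  show ?thesis
    using polygroupoid_shifted_structure[of p q r f]
      representation_shifted_structure[of p q r s t f] assms(3,4,7,8)
    unfolding representable_def by auto
qed

end
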